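(* Let $N \cong \mathbb{Z}^2$ be a lattice of rank $2$, let $\Delta \subseteq N_{\mathbb{R}}$ be an LDP polygon, and let $\sigma \in \Sigma_\Delta[2]$ be a $2$-dimensional cone of the spanning fan $\Sigma_\Delta$ of $\Delta$. Then $$12\sum_{n\in \nabla_\sigma^{\circ} \cap N}(\kappa(n)+1)^2 = v\left(\nabla_\sigma \setminus \mathrm{sail}_\sigma \right)+ \sum_{i=1}^{k_\sigma-1} v\bigl(\mathrm{conv}(m_\sigma, m_{\sigma,i}, m_{\sigma,i+1})\bigr),$$ where $\kappa = \kappa_\Delta|_{\sigma}$ is the linear function given as the restriction to $\sigma$ of the piecewise linear function $\kappa_\Delta \colon N_{\mathbb{R}} \to \mathbb{R}$, $x \mapsto -\min\{\lambda \in \mathbb{R}_{\geq 0} \mid x \in \lambda\Delta\}$.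
   Context: Let $N$ be a free abelian group of rank $2$, $M = \mathrm{Hom}(N,\mathbb{Z})$, $N_{\mathbb{R}} = N\otimes_{\mathbb{Z}}\mathbb{R}$, $M_{\mathbb{R}} = M\otimes_{\mathbb{Z}}\mathbb{R}$, with natural pairing $\langle\cdot,\cdot\rangle \colon M_{\mathbb{R}}\times N_{\mathbb{R}}\to\mathbb{R}$. An LDP polygon is a $2$-dimensional convex polygon $\Delta \subseteq N_{\mathbb{R}}$ whose vertices are primitive lattice points of $N$ and which contains the origin in its interior. Its spanning fan $\Sigma_\Delta$ consists of the cones $\mathbb{R}_{\ge 0}\theta$ over the (proper) faces $\theta$ of $\Delta$; $\Sigma_\Delta[2]$ is the set of its $2$-dimensional cones, i.e. the cones over the edges of $\Delta$. For a $2$-dimensional cone $\sigma \in \Sigma_\Delta[2]$ with primitive ray generators $u_1,u_2 \in N$ (which are the endpoints of the corresponding edge of $\Delta$): - $\nabla_\sigma = \mathrm{conv}(0,u_1,u_2)$, and $\nabla_\sigma^\circ$ is its (relative) interior. The function $\kappa$ is linear on $\sigma$ with $\kappa(u_1)=\kappa(u_2)=-1$. - $\mathrm{sail}_\sigma = \nabla_\sigma \setminus \mathrm{conv}\bigl((\nabla_\sigma\cap N)\setminus\{0\}\bigr)$, so that $\nabla_\sigma\setminus \mathrm{sail}_\sigma = \mathrm{conv}\bigl((\nabla_\sigma\cap N)\setminus\{0\}\bigr)$. Its closure is denoted $\overline{\mathrm{sail}}_\sigma$. - The nonzero lattice points of $\overline{\mathrm{sail}}_\sigma$ (all of which lie on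 its boundary), ordered consecutively from $u_2$ to $u_1$, are denoted $p_0=u_2,p_1,\dots,p_{k_\sigma}=u_1$. The rays through them subdivide $\sigma$ into $k_\sigma$ unimodular cones $\sigma_i=\mathrm{cone}(p_{i-1},p_i)$, $i=1,\dots,k_\sigma$ (unimodular means that the primitive generators form a $\mathbb{Z}$-basis of $N$). - $m_\sigma\in M_{\mathbb{R}}$ is the unique vector with $\langle m_\sigma,u_1\rangle=\langle m_\sigma,u_2\rangle=-1$, and for $i=1,\dots,k_\sigma$, $m_{\sigma,i}\in M$ is the unique vector with $\langle m_{\sigma,i},p_{i-1}\rangle=\langle m_{\sigma,i},p_i\rangle=-1$. The normalized volume $v(P)$ is $2$ times the area of $P$, where area in $N_{\mathbb{R}}$ (resp. $M_{\mathbb{R}}$) is normalized so that a fundamental parallelogram of $N$ (resp. $M$) has area $1$; it is $0$ if $P$ is degenerate (of dimension less than $2$). An empty sum is $0$. *)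

theory Defs
  imports "HOL-Analysis.Analysis"
begin

text \<open>
  A rank 2 lattice \<open>N\<close> is given together with \<open>N\<^sub>\<real> = \<real>\<^sup>2\<close> as the set of integer combinations
  of an arbitrary basis of \<open>\<real>\<^sup>2\<close>. The space \<open>M\<^sub>\<real>\<close> of linear forms on \<open>N\<^sub>\<real>\<close> is identified with
  \<open>\<real>\<^sup>2\<close> by the inner product, so that the natural pairing is \<open>m \<bullet> n\<close>.
\<close>

definition lattice_basis :: "(real^2) set \<Rightarrow> real^2 \<Rightarrow> real^2 \<Rightarrow> bool" where
  "lattice_basis N b1 b2 \<longleftrightarrow> b1 \<noteq> b2 \<and> independent {b1, b2} \<and>
     N = {of_int x *\<^sub>R b1 + of_int y *\<^sub>R b2 | x y. True}"

definition is_lattice :: "(real^2) set \<Rightarrow> bool" where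
  "is_lattice N \<longleftrightarrow> (\<exists>b1 b2. lattice_basis N b1 b2)"

definition dual_lattice :: "(real^2) set \<Rightarrow> (real^2) set" where
  "dual_lattice N = {m. \<forall>n\<in>N. m \<bullet> n \<in> \<int>}"

definition parallelogram :: "real^2 \<Rightarrow> real^2 \<Rightarrow> (real^2) set" where
  "parallelogram b1 b2 = {s *\<^sub>R b1 + t *\<^sub>R b2 | s t. s \<in> {0..1} \<and> t \<in> {0..1}}"

text \<open>The area of a fundamental parallelogram does not depend on the basis, see
  \<open>covolume_eq\<close> below.\<close>

definition covolume :: "(real^2) set \<Rightarrow> real" where
  "covolume L = (THE c. \<exists>b1 b2. lattice_basis L b1 b2 \<and> c = measure lebesgue (parallelogram b1 b2))"

definition normalized_volume :: "(real^2) set \<Rightarrow> (real^2) set \<Rightarrow> real" where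
  "normalized_volume L P = 2 * (measure lebesgue P / covolume L)"

definition primitive :: "(real^2) set \<Rightarrow> real^2 \<Rightarrow> bool" where
  "primitive N v \<longleftrightarrow> v \<in> N \<and> v \<noteq> 0 \<and> (\<forall>w\<in>N. \<forall>c::int. v = of_int c *\<^sub>R w \<longrightarrow> \<bar>c\<bar> = 1)"

definition LDP_polygon :: "(real^2) set \<Rightarrow> (real^2) set \<Rightarrow> bool" where
  "LDP_polygon N \<Delta> \<longleftrightarrow> polytope \<Delta> \<and> aff_dim \<Delta> = 2 \<and>
     (\<forall>v. v extreme_point_of \<Delta> \<longrightarrow> primitive N v) \<and> 0 \<in> interior \<Delta>"

text \<open>The empty set is a proper face; inserting \<open>0\<close> makes its cone the zero cone.\<close>

definition spanning_fan :: "(real^2) set \<Rightarrow> (real^2) set set" where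
  "spanning_fan \<Delta> = {insert 0 (conic hull \<theta>) | \<theta>. \<theta> face_of \<Delta> \<and> \<theta> \<noteq> \<Delta>}"

definition spanning_fan2 :: "(real^2) set \<Rightarrow> (real^2) set set" where
  "spanning_fan2 \<Delta> = {\<sigma> \<in> spanning_fan \<Delta>. aff_dim \<sigma> = 2}"

definition primitive_generators :: "(real^2) set \<Rightarrow> (real^2) set \<Rightarrow> real^2 \<Rightarrow> real^2 \<Rightarrow> bool" where
  "primitive_generators N \<sigma> u1 u2 \<longleftrightarrow>
     primitive N u1 \<and> primitive N u2 \<and> \<sigma> = convex_cone hull {u1, u2}"

text \<open>\<open>LEAST\<close> is the minimum of a set of real numbers here; it exists when \<open>\<Delta>\<close> is an
  LDP polygon.\<close>

definition kappa :: "(real^2) set \<Rightarrow> real^2 \<Rightarrow> real" where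
  "kappa \<Delta> x = - (LEAST l::real. l \<ge> 0 \<and> x \<in> (\<lambda>y. l *\<^sub>R y) ` \<Delta>)"

definition nabla :: "real^2 \<Rightarrow> real^2 \<Rightarrow> (real^2) set" where
  "nabla u1 u2 = convex hull {0, u1, u2}"

definition sail :: "(real^2) set \<Rightarrow> real^2 \<Rightarrow> real^2 \<Rightarrow> (real^2) set" where
  "sail N u1 u2 = nabla u1 u2 - convex hull (nabla u1 u2 \<inter> N - {0})"

text \<open>\<open>p 0, \<dots>, p k\<close> enumerates the nonzero lattice points of the closed sail in angular order
  from \<open>u2\<close> to \<open>u1\<close>: each point lies in the cone between any earlier point and \<open>u1\<close>.\<close>

definition sail_points :: "(real^2) set \<Rightarrow> real^2 \<Rightarrow> real^2 \<Rightarrow> nat \<Rightarrow> (nat \<Rightarrow> real^2) \<Rightarrow> bool" where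
  "sail_points N u1 u2 k p \<longleftrightarrow>
     bij_betw p {0..k} (closure (sail N u1 u2) \<inter> N - {0}) \<and> p 0 = u2 \<and> p k = u1 \<and>
     (\<forall>i j. i \<le> j \<and> j \<le> k \<longrightarrow> p j \<in> convex_cone hull {p i, u1})"

definition m_cone :: "real^2 \<Rightarrow> real^2 \<Rightarrow> real^2" where
  "m_cone u1 u2 = (THE m. m \<bullet> u1 = -1 \<and> m \<bullet> u2 = -1)"

definition m_sub :: "(real^2) set \<Rightarrow> (nat \<Rightarrow> real^2) \<Rightarrow> nat \<Rightarrow> real^2" where
  "m_sub N p i = (THE m. m \<in> dual_lattice N \<and> m \<bullet> p (i - 1) = -1 \<and> m \<bullet> p i = -1)"

lemma parallelogram_measure:
  "measure lebesgue (parallelogram b1 b2) = \<bar>b1$1 * b2$2 - b1$2 * b2$1\<bar>"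
proof -
  define f where "f = (\<lambda>x::real^2. x$1 *\<^sub>R b1 + x$2 *\<^sub>R b2)"
  have lin: "linear f"
    unfolding f_def by (intro linearI) (simp_all add: algebra_simps)
  have eq: "parallelogram b1 b2 = f ` cbox 0 (vec 1)"
  proof -
    have "s *\<^sub>R b1 + t *\<^sub>R b2 \<in> f ` cbox 0 (vec 1)" if "s \<in> {0..1}" "t \<in> {0..1}" for s t
      using that
      by (intro image_eqI[where x = "vector [s, t]"])
         (auto simp: f_def mem_box_cart forall_2 vector_2)
    thus ?thesis
      by (auto simp: parallelogram_def f_def mem_box_cart forall_2) blast
  qed
  have "measure lebesgue (f ` cbox 0 (vec 1)) = \<bar>det (matrix f)\<bar> * measure lebesgue (cbox (0::real^2) (vec 1))"
    by (rule measure_linear_image[OF lin]) auto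
  moreover have "measure lebesgue (cbox (0::real^2) (vec 1)) = 1"
  proof -
    have "measure lebesgue (cbox (0::real^2) (vec 1)) = measure lborel (cbox (0::real^2) (vec 1))"
      by (rule measure_completion) simp
    also have "\<dots> = (\<Prod>i\<in>UNIV. vec 1 $ i - (0::real^2) $ i)"
      by (rule content_cbox_cart) (simp only: interval_ne_empty_cart, simp)
    finally show ?thesis by simp
  qed
  moreover have "det (matrix f) = b1$1 * b2$2 - b1$2 * b2$1"
    by (simp add: det_2 matrix_def f_def axis_def algebra_simps)
  ultimately show ?thesis by (simp add: eq)
qed

lemma independent_2_det:
  fixes b1 b2 :: "real^2"
  assumes "b1 \<noteq> b2" "independent {b1, b2}"
  shows "b1$1 * b2$2 - b1$2 * b2$1 \<noteq> 0"
proof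
  assume *: "b1$1 * b2$2 - b1$2 * b2$1 = 0"
  have A: "x = 0 \<and> y = 0" if "x *\<^sub>R b1 + y *\<^sub>R b2 = 0" for x y :: real
  proof -
    let ?c = "\<lambda>v. if v = b1 then x else y"
    have sum0: "(\<Sum>v\<in>{b1,b2}. ?c v *\<^sub>R v) = 0"
      using that assms(1) by simp
    have "?c b1 = 0" "?c b2 = 0"
      using independentD[OF assms(2), of "{b1,b2}" ?c] sum0 by blast+
    thus ?thesis using assms(1) by simp
  qed
  have "b2$2 *\<^sub>R b1 + (- b1$2) *\<^sub>R b2 = 0" "b2$1 *\<^sub>R b1 + (- b1$1) *\<^sub>R b2 = 0"
    using * by (simp_all add: vec_eq_iff forall_2 mult.commute)
  from A[OF this(1)] A[OF this(2)] have "b1$1 = 0" "b1$2 = 0" by simp_all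
  hence "b1 = 0" by (simp add: vec_eq_iff forall_2)
  thus False using assms(2) dependent_zero by auto
qed

lemma covolume_eq:
  assumes "lattice_basis L b1 b2"
  shows "covolume L = \<bar>b1$1 * b2$2 - b1$2 * b2$1\<bar>"
proof -
  let ?d = "\<lambda>b1 b2::real^2. b1$1 * b2$2 - b1$2 * b2$1"
  have dvd: "\<exists>k::int. k \<noteq> 0 \<and> ?d c1 c2 = of_int k * ?d b1 b2"
    if b: "lattice_basis L b1 b2" and c: "lattice_basis L c1 c2" for b1 b2 c1 c2
  proof -
    have "c1 = of_int 1 *\<^sub>R c1 + of_int 0 *\<^sub>R c2" "c2 = of_int 0 *\<^sub>R c1 + of_int 1 *\<^sub>R c2" by auto
    hence "c1 \<in> L" "c2 \<in> L" using c unfolding lattice_basis_def by blast+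
    then obtain x y z w where e: "c1 = of_int x *\<^sub>R b1 + of_int y *\<^sub>R b2"
      "c2 = of_int z *\<^sub>R b1 + of_int w *\<^sub>R b2"
      using b unfolding lattice_basis_def by blast
    have "?d c1 c2 = of_int (x*w - y*z) * ?d b1 b2"
      unfolding e by (simp add: algebra_simps)
    moreover have "?d c1 c2 \<noteq> 0" using c independent_2_det unfolding lattice_basis_def by blast
    ultimately show ?thesis by (metis mult_zero_left of_int_0)
  qed
  have le: "\<bar>?d b1 b2\<bar> \<le> \<bar>?d c1 c2\<bar>"
    if "lattice_basis L b1 b2" "lattice_basis L c1 c2" for b1 b2 c1 c2
  proof -
    obtain k :: int where k: "k \<noteq> 0" "?d c1 c2 = of_int k * ?d b1 b2"
      using dvd[OF \<open>lattice_basis L b1 b2\<close> \<open>lattice_basis L c1 c2\<close>] by blast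
    have "1 \<le> \<bar>of_int k :: real\<bar>" using k(1) by linarith
    hence "1 * \<bar>?d b1 b2\<bar> \<le> \<bar>of_int k\<bar> * \<bar>?d b1 b2\<bar>" by (intro mult_right_mono) auto
    thus ?thesis unfolding k(2) abs_mult by simp
  qed
  show ?thesis unfolding covolume_def parallelogram_measure
    by (rule the_equality) (use assms le in \<open>auto intro: antisym\<close>)
qed

end

theory Submission
  imports Defs
begin

text \<open>
  Choose a basis \<open>e\<^sub>1, e\<^sub>2\<close> of the lattice with the edge from \<open>u\<^sub>2\<close> to \<open>u\<^sub>1\<close> horizontal:
  \<open>u\<^sub>1 = (s, l)\<close>, \<open>u\<^sub>2 = (t, l)\<close>, so \<open>\<kappa>(x, y) = - y / l\<close>. Counting interior points row by row, the
  left hand side is a weighted sum of \<open>\<lfloor>s y / l\<rfloor> - \<lfloor>t y / l\<rfloor>\<close>, which is elementary up to the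
  difference of the Dedekind sums of \<open>s / l\<close> and \<open>t / l\<close>. The sail points \<open>p\<^sub>i = (x\<^sub>i, y\<^sub>i)\<close> form a
  chain of unimodular pairs from \<open>u\<^sub>2\<close> to \<open>u\<^sub>1\<close>, and by the reciprocity law the Dedekind sums of
  \<open>x\<^sub>i / y\<^sub>i\<close> change along each pair by an elementary expression, which telescopes in terms of the
  integers \<open>a\<^sub>i\<close> given by \<open>p\<^sub>i\<^sub>-\<^sub>1 + p\<^sub>i\<^sub>+\<^sub>1 = a\<^sub>i p\<^sub>i\<close>. On the right hand side the sail has normalized volume \<open>k\<close>,
  and the \<open>i\<close>-th dual triangle has normalized volume \<open>(a\<^sub>i - 2) (1 - y\<^sub>i / l)\<close>.
\<close>

subsection \<open>Dedekind sums\<close>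

text \<open>The row weight \<open>(1 - y / l)^2\<close> is quadratic, yet nothing worse than
  Dedekind sums survives: under \<open>y -> l - y\<close> the fractional part of
  \<open>s y / l\<close> becomes its complement, so its quadratic moment cancels and only the linear
  one remains. Reciprocity then yields three kinds of terms for a unimodular pair. The term
  \<open>1 / (y y')\<close> is the increment of the slope \<open>x / y\<close> and telescopes; the
  ratios \<open>y / y'\<close> and \<open>y' / y\<close>, regrouped by denominators, produce the
  \<open>a_i\<close>; the constant -3 per pair, against the -2 in each \<open>a_i - 2\<close>,
  leaves -1 per pair, which is the volume of the sail. The obstacle on the geometric side is that
  the sail points are given only as an angular enumeration of lattice points in a topological
  closure. Primitivity, unimodularity of neighbours and \<open>a_i >= 2\<close> all have to be
  derived. They follow from one condition on rays: no point strictly before a sail point on its ray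
  belongs to the hull of the nonzero lattice points. The bound \<open>a_i >= 2\<close> also fixes
  the sign of the determinant of each dual triangle, so that its volume carries no absolute
  value.\<close>

lemma bij_betw_mult_mod:
  fixes h h' k :: int
  assumes "0 < k" "(h * h') mod k = 1 mod k"
  shows "bij_betw (\<lambda>r. (h * r) mod k) {0..<k} {0..<k}"
proof (rule bij_betw_byWitness[where f' = "\<lambda>r. (h' * r) mod k"])
  have *: "(h * (h' * r mod k)) mod k = r" "(h' * (h * r mod k)) mod k = r" if "r \<in> {0..<k}" for r
  proof -
    have "(h * (h' * r mod k)) mod k = ((h * h') mod k * r) mod k"
      by (simp add: mod_mult_right_eq mod_mult_left_eq mult.assoc)
    also have "\<dots> = r" using that by (simp add: assms(2) mod_mult_left_eq)
    finally show "(h * (h' * r mod k)) mod k = r" .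
    have "(h' * (h * r mod k)) mod k = ((h * h') mod k * r) mod k"
      by (simp add: mod_mult_right_eq mod_mult_left_eq ac_simps)
    also have "\<dots> = r" using that by (simp add: assms(2) mod_mult_left_eq)
    finally show "(h' * (h * r mod k)) mod k = r" .
  qed
  show "\<forall>a\<in>{0..<k}. h' * (h * a mod k) mod k = a" "\<forall>a\<in>{0..<k}. h * (h' * a mod k) mod k = a"
    using * by auto
qed (use assms in auto)

lemma coprime_inverse_mod:
  fixes h k :: int
  assumes "coprime h k"
  obtains h' where "(h * h') mod k = 1 mod k"
proof -
  obtain u v where "u * h + v * k = 1" using assms by (metis bezout_int coprime_iff_gcd_eq_1)
  hence "h * u = 1 + (-v) * k" by (simp add: algebra_simps)
  hence "(h * u) mod k = 1 mod k" by (metis mod_mult_self1)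
  thus ?thesis using that by blast
qed

lemma sum_mult_mod_permute:
  fixes h k :: int and f :: "int \<Rightarrow> 'a::comm_monoid_add"
  assumes "0 < k" "coprime h k"
  shows "(\<Sum>r\<in>{0..<k}. f ((h * r) mod k)) = (\<Sum>r\<in>{0..<k}. f r)"
proof -
  obtain h' where "(h * h') mod k = 1 mod k" using coprime_inverse_mod[OF assms(2)] .
  from sum.reindex_bij_betw[OF bij_betw_mult_mod[OF assms(1) this]] show ?thesis .
qed

text \<open>For \<open>h\<close> coprime to \<open>k > 0\<close> this is the classical sum of
  \<open>((r/k)) ((hr/k))\<close> with the sawtooth \<open>((x)) = x - floor x - 1/2\<close>,
  multiplied out over \<open>0 < r < k\<close>: the two linear terms give \<open>-(k - 1)/4\<close>
  each, the constant term gives \<open>+(k - 1)/4\<close>.\<close>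

definition dedekind_sum :: "int \<Rightarrow> int \<Rightarrow> real" where
  "dedekind_sum h k = (\<Sum>r\<in>{0..<k}. of_int (r * ((h * r) mod k))) / of_int k ^ 2 - (of_int k - 1) / 4"

lemma sum_int_powers:
  fixes k :: int
  assumes "0 < k"
  shows "2 * (\<Sum>r\<in>{0..<k}. real_of_int r) = of_int k * (of_int k - 1)"
    and "6 * (\<Sum>r\<in>{0..<k}. real_of_int r ^ 2) = of_int k * (of_int k - 1) * (2 * of_int k - 1)"
    and "4 * (\<Sum>r\<in>{0..<k}. real_of_int r ^ 3) = of_int k ^ 2 * (of_int k - 1) ^ 2"
proof -
  have "2 * (\<Sum>r\<in>{0..<int n}. real_of_int r) = real n * (real n - 1)
     \<and> 6 * (\<Sum>r\<in>{0..<int n}. real_of_int r ^ 2) = real n * (real n - 1) * (2 * real n - 1)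
     \<and> 4 * (\<Sum>r\<in>{0..<int n}. real_of_int r ^ 3) = real n ^ 2 * (real n - 1) ^ 2" for n
  proof (induction n)
    case (Suc n)
    have "{0..<int (Suc n)} = insert (int n) {0..<int n}" by auto
    thus ?case using Suc by (simp add: algebra_simps power2_eq_square power3_eq_cube)
  qed simp
  from this[of "nat k"] assms
  show "2 * (\<Sum>r\<in>{0..<k}. real_of_int r) = of_int k * (of_int k - 1)"
    and "6 * (\<Sum>r\<in>{0..<k}. real_of_int r ^ 2) = of_int k * (of_int k - 1) * (2 * of_int k - 1)"
    and "4 * (\<Sum>r\<in>{0..<k}. real_of_int r ^ 3) = of_int k ^ 2 * (of_int k - 1) ^ 2"
    by simp_all
qed

text \<open>Reindexing by \<open>r -> h r mod k\<close> interchanges the two factors of each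
  summand.\<close>

lemma dedekind_sum_inverse:
  assumes "0 < k" "(h * h') mod k = 1 mod k"
  shows "dedekind_sum h k = dedekind_sum h' k"
proof -
  have eq: "(h' * ((h * r) mod k)) mod k = r" if "r \<in> {0..<k}" for r
  proof -
    have "(h' * (h * r mod k)) mod k = ((h * h') mod k * r) mod k"
      by (simp add: mod_mult_right_eq mod_mult_left_eq ac_simps)
    also have "\<dots> = r" using that by (simp add: assms(2) mod_mult_left_eq)
    finally show ?thesis .
  qed
  have "(\<Sum>r\<in>{0..<k}. real_of_int (r * ((h' * r) mod k)))
      = (\<Sum>r\<in>{0..<k}. real_of_int (((h * r) mod k) * ((h' * ((h * r) mod k)) mod k)))"
    by (rule sum.reindex_bij_betw[OF bij_betw_mult_mod[OF assms], symmetric])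
  also have "\<dots> = (\<Sum>r\<in>{0..<k}. real_of_int (r * ((h * r) mod k)))"
    by (intro sum.cong) (use eq in \<open>simp_all add: mult.commute\<close>)
  finally show ?thesis by (simp add: dedekind_sum_def)
qed

text \<open>For \<open>0 < r < k\<close> the residues of \<open>h r\<close> and \<open>-h r\<close>
  add up to \<open>k\<close>; the constant \<open>(k - 1)/4\<close> in the definition is what turns
  this complement into a change of sign.\<close>

lemma dedekind_sum_minus:
  assumes "0 < k" "coprime h k"
  shows "dedekind_sum (- h) k = - dedekind_sum h k"
proof -
  have eq: "real_of_int (r * ((- h * r) mod k)) = of_int k * of_int r - of_int (r * ((h * r) mod k))"
    if "r \<in> {0..<k}" for r
  proof (cases "r = 0")
    case False
    have "\<not> k dvd h * r"
    proof
      assume "k dvd h * r"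
      hence "k dvd r" using assms(2) by (simp add: coprime_commute coprime_dvd_mult_right_iff)
      thus False using that False zdvd_not_zless by (metis atLeastLessThan_iff le_less)
    qed
    hence "(- (h * r)) mod k = k - (h * r) mod k" by (simp add: zmod_zminus1_eq_if dvd_eq_mod_eq_0)
    hence "(- h * r) mod k = k - (h * r) mod k" by simp
    thus ?thesis by (simp only: of_int_mult of_int_diff right_diff_distrib) simp
  qed simp
  have "(\<Sum>r\<in>{0..<k}. real_of_int (r * ((- h * r) mod k)))
     = of_int k * (\<Sum>r\<in>{0..<k}. of_int r) - (\<Sum>r\<in>{0..<k}. of_int (r * ((h * r) mod k)))"
    by (simp only: sum.cong[OF refl eq] sum_subtractf sum_distrib_left)
  also have "(\<Sum>r\<in>{0..<k}. real_of_int r) = of_int k * (of_int k - 1) / 2"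
    using sum_int_powers(1)[OF assms(1)] by simp
  finally have eqn: "(\<Sum>r\<in>{0..<k}. real_of_int (r * ((- h * r) mod k)))
     = of_int k * (of_int k * (of_int k - 1) / 2) - (\<Sum>r\<in>{0..<k}. of_int (r * ((h * r) mod k)))" .
  show ?thesis unfolding dedekind_sum_def eqn using assms(1)
    by (simp add: field_simps power2_eq_square)
qed

lemma int_div_less_iff:
  fixes m n q :: int
  assumes "0 < q"
  shows "m div q < n \<longleftrightarrow> m < n * q"
proof -
  have "(m + (- n) * q) div q = m div q - n"
    using assms by (subst div_mult_self1) auto
  thus ?thesis using pos_imp_zdiv_neg_iff[OF assms, of "m + (- n) * q"] by simp
qed

text \<open>The sum of squares of \<open>\<lfloor>h r / k\<rfloor>\<close> is turned into a sum over the lattice points below the diagonal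
  and then summed in the other direction.\<close>

lemma sum_square_div:
  fixes h k :: int
  assumes "0 < h" "0 < k" "coprime h k"
  shows "(\<Sum>r\<in>{0..<k}. ((h * r) div k) ^ 2)
       = (\<Sum>j\<in>{0..<h}. (2 * j - 1) * (k - 1 - (k * j) div h)) + (k - 1)"
proof -
  have odd: "(\<Sum>j\<in>{1..n}. 2 * j - 1) = n ^ 2" if "0 \<le> n" for n :: int
    using that
  proof (induction n rule: int_ge_induct)
    case (step i)
    have "{1..i + 1} = insert (i + 1) {1..i}" using step by auto
    thus ?case using step by (simp add: power2_eq_square algebra_simps)
  qed simp
  \<comment> \<open>A square is the sum of the first odd numbers, so
    \<open>((h * r) div k)^2\<close> becomes a weighted count of the \<open>j\<close> below the
    diagonal.\<close>
  have a: "((h * r) div k) ^ 2 = (\<Sum>j\<in>{1..<h}. if k * j \<le> h * r then 2 * j - 1 else 0)"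
    if r: "r \<in> {0..<k}" for r
  proof -
    have "{j\<in>{1..<h}. k * j \<le> h * r} = {1..(h * r) div k}"
    proof -
      have "j < h" if "k * j \<le> h * r" for j
      proof -
        have "h * r < h * k" using r assms by simp
        hence "k * j < k * h" using that by (simp add: mult.commute)
        thus ?thesis using assms by simp
      qed
      moreover have "k * j \<le> h * r \<longleftrightarrow> j \<le> (h * r) div k" for j
        using int_div_less_iff[OF assms(2), of "h * r" j]
        by (simp add: mult.commute flip: not_less)
      ultimately show ?thesis by auto
    qed
    moreover have "(h * r) div k \<ge> 0" using r assms by (simp add: pos_imp_zdiv_nonneg_iff)
    ultimately show ?thesis
      using odd[of "(h * r) div k"] by (simp add: sum.If_cases Int_def)
  qed
  have b: "(\<Sum>r\<in>{0..<k}. if k * j \<le> h * r then 2 * j - 1 else 0) = (2 * j - 1) * (k - 1 - (k * j) div h)"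
    if j: "j \<in> {1..<h}" for j
  proof -
    \<comment> \<open>No lattice point with \<open>0 < j < h\<close> lies on the diagonal, so
      \<open><=\<close> may be replaced by \<open><\<close> in the count over
      \<open>r\<close>.\<close>
    have nd: "\<not> h dvd k * j"
    proof
      assume "h dvd k * j"
      hence "h dvd j" using assms(3) by (simp add: coprime_dvd_mult_right_iff)
      thus False using j zdvd_not_zless by auto
    qed
    have "{r\<in>{0..<k}. k * j \<le> h * r} = {(k * j) div h + 1..k - 1}"
    proof -
      have "(k * j \<le> h * r) = ((k * j) div h < r)" for r
      proof -
        have "(k * j) div h < r \<longleftrightarrow> k * j < h * r" using assms(1) by (simp add: int_div_less_iff mult.commute)
        moreover have "k * j \<noteq> h * r" using nd by auto
        ultimately show ?thesis by linarith
      qed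
      moreover have "(k * j) div h \<ge> 0" using j assms by (simp add: pos_imp_zdiv_nonneg_iff)
      moreover have "{r\<in>{0..<k}. D < r} = {D + 1..k - 1}" if "0 \<le> D" for D using that by auto
      ultimately show ?thesis by simp
    qed
    moreover have "(k * j) div h < k"
      using j assms by (simp add: int_div_less_iff)
    ultimately show ?thesis by (simp add: sum.If_cases Int_def)
  qed
  \<comment> \<open>The row \<open>j = 0\<close> is absent from the count but contributes
    \<open>-(k - 1)\<close> to the stated sum; the extra summand \<open>k - 1\<close> compensates
    for it.\<close>
  have ins: "{0..<h} = insert 0 {1..<h}" using assms by auto
  have "(\<Sum>r\<in>{0..<k}. ((h * r) div k) ^ 2)
      = (\<Sum>j\<in>{1..<h}. \<Sum>r\<in>{0..<k}. if k * j \<le> h * r then 2 * j - 1 else 0)"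
    by (simp add: a) (rule sum.swap)
  also have "\<dots> = (\<Sum>j\<in>{1..<h}. (2 * j - 1) * (k - 1 - (k * j) div h))"
    using b by (intro sum.cong) auto
  finally show ?thesis by (simp add: ins)
qed

lemma of_int_div_mod: "real_of_int (a mod b) = of_int a - of_int b * of_int (a div b)"
  by (metis mod_div_mult_eq minus_mult_div_eq_mod of_int_diff of_int_mult)

text \<open>\<open>A\<close> and \<open>B\<close> carry the two Dedekind sums. Since
  \<open>r -> h r mod k\<close> permutes the residues, the sum of squared residues is known, which
  ties \<open>A\<close> to \<open>F\<close>; \<open>sum_square_div\<close> ties \<open>F\<close> to
  \<open>B\<close> and \<open>G\<close>; the sum of residues gives \<open>G\<close>. After solving
  for \<open>A\<close> and \<open>B\<close>, the unknown \<open>F\<close> enters the two sums with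
  opposite signs and cancels.\<close>

lemma dedekind_reciprocity:
  assumes "0 < h" "0 < k" "coprime h k"
  shows "12 * (dedekind_sum h k + dedekind_sum k h)
       = of_int h / of_int k + of_int k / of_int h + 1 / (of_int h * of_int k) - 3"
proof -
  define H K where "H = real_of_int h" and "K = real_of_int k"
  have pos: "H > 0" "K > 0" using assms by (auto simp: H_def K_def)
  define A where "A = (\<Sum>r\<in>{0..<k}. real_of_int r * of_int ((h * r) div k))"
  define B where "B = (\<Sum>j\<in>{0..<h}. real_of_int j * of_int ((k * j) div h))"
  define F where "F = (\<Sum>r\<in>{0..<k}. real_of_int ((h * r) div k) ^ 2)"
  define G where "G = (\<Sum>j\<in>{0..<h}. real_of_int ((k * j) div h))"
  have P: "(\<Sum>r\<in>{0..<k}. real_of_int r ^ 2) = K * (K - 1) * (2 * K - 1) / 6"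
    "(\<Sum>r\<in>{0..<h}. real_of_int r ^ 2) = H * (H - 1) * (2 * H - 1) / 6"
    "(\<Sum>r\<in>{0..<h}. real_of_int r) = H * (H - 1) / 2"
    using sum_int_powers[OF assms(1)] sum_int_powers[OF assms(2)] by (simp_all add: H_def K_def)
  have "(\<Sum>r\<in>{0..<k}. real_of_int ((h * r) mod k) ^ 2) = K * (K - 1) * (2 * K - 1) / 6"
    using sum_mult_mod_permute[OF assms(2,3), of "\<lambda>r. real_of_int r ^ 2"] P(1) by simp
  moreover have "(\<Sum>r\<in>{0..<k}. real_of_int ((h * r) mod k) ^ 2)
      = H^2 * (\<Sum>r\<in>{0..<k}. real_of_int r ^ 2) - 2 * H * K * A + K^2 * F"
    unfolding of_int_div_mod A_def F_def H_def K_def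
    by (simp add: power2_eq_square algebra_simps sum.distrib sum_subtractf sum_distrib_left)
  ultimately have e1: "H^2 * (K * (K - 1) * (2 * K - 1) / 6) - 2 * H * K * A + K^2 * F = K * (K - 1) * (2 * K - 1) / 6"
    using P(1) by simp
  have "(\<Sum>r\<in>{0..<h}. real_of_int ((k * r) mod h)) = H * (H - 1) / 2"
    using sum_mult_mod_permute[OF assms(1), of k real_of_int] P(3) assms(3) by (simp add: coprime_commute)
  moreover have "(\<Sum>r\<in>{0..<h}. real_of_int ((k * r) mod h)) = K * (\<Sum>r\<in>{0..<h}. real_of_int r) - H * G"
    unfolding of_int_div_mod G_def H_def K_def
    by (simp add: sum_subtractf sum_distrib_left)
  ultimately have "H * G = H * ((K - 1) * (H - 1) / 2)" using P(3) by (simp add: field_simps)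
  hence e2: "G = (K - 1) * (H - 1) / 2" using pos by (metis mult_left_cancel less_irrefl)
  have "F = real_of_int (\<Sum>r\<in>{0..<k}. ((h * r) div k) ^ 2)" by (simp add: F_def)
  also have "\<dots> = (\<Sum>j\<in>{0..<h}. (2 * real_of_int j - 1) * (K - 1 - of_int ((k * j) div h))) + (K - 1)"
    unfolding sum_square_div[OF assms] by (simp add: K_def)
  also have "(\<Sum>j\<in>{0..<h}. (2 * real_of_int j - 1) * (K - 1 - of_int ((k * j) div h)))
      = (K - 1) * (2 * (\<Sum>j\<in>{0..<h}. real_of_int j) - H) - 2 * B + G"
    unfolding B_def G_def using assms(1)
    by (simp add: algebra_simps sum.distrib sum_subtractf sum_distrib_left H_def)
  finally have e3: "F = (K - 1) * (H * (H - 1) - H) - 2 * B + G + K - 1" using P(3) by simp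
  have dk: "dedekind_sum h k = (H * (K * (K - 1) * (2 * K - 1) / 6) - K * A) / K^2 - (K - 1) / 4"
  proof -
    have "(\<Sum>r\<in>{0..<k}. real_of_int (r * ((h * r) mod k))) = H * (\<Sum>r\<in>{0..<k}. real_of_int r ^ 2) - K * A"
      unfolding of_int_mult of_int_div_mod A_def H_def K_def
      by (simp add: power2_eq_square algebra_simps sum_subtractf sum_distrib_left)
    thus ?thesis unfolding dedekind_sum_def P by (simp add: K_def)
  qed
  have dh: "dedekind_sum k h = (K * (H * (H - 1) * (2 * H - 1) / 6) - H * B) / H^2 - (H - 1) / 4"
  proof -
    have "(\<Sum>r\<in>{0..<h}. real_of_int (r * ((k * r) mod h))) = K * (\<Sum>r\<in>{0..<h}. real_of_int r ^ 2) - H * B"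
      unfolding of_int_mult of_int_div_mod B_def H_def K_def
      by (simp add: power2_eq_square algebra_simps sum_subtractf sum_distrib_left)
    thus ?thesis unfolding dedekind_sum_def P by (simp add: H_def)
  qed
  have B: "B = ((K - 1) * (H * (H - 1) - H) + G + K - 1 - F) / 2" using e3 by simp
  have A: "A = (H^2 * (K * (K - 1) * (2 * K - 1) / 6) + K^2 * F - K * (K - 1) * (2 * K - 1) / 6) / (2 * H * K)"
    using e1 pos by (simp add: field_simps)
  show ?thesis unfolding dk dh A B e2 using pos
    unfolding H_def[symmetric] K_def[symmetric]
    by (simp add: field_simps power2_eq_square)
qed

text \<open>The determinant condition says that \<open>x'\<close> inverts \<open>y\<close> modulo
  \<open>y'\<close> and \<open>-x\<close> inverts \<open>y'\<close> modulo \<open>y\<close>. So the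
  difference on the left is the sum of the Dedekind sums of \<open>(y, y')\<close> and
  \<open>(y', y)\<close>, which is what reciprocity evaluates.\<close>

lemma dedekind_sum_unimodular_step:
  fixes x y x' y' :: int
  assumes "0 < y" "0 < y'" "x' * y - x * y' = 1"
  shows "12 * (dedekind_sum x' y' - dedekind_sum x y)
       = of_int y / of_int y' + of_int y' / of_int y + 1 / (of_int y * of_int y') - 3"
proof -
  have cop: "coprime y y'"
    by (rule coprimeI) (metis assms(3) dvd_diff dvd_mult)
  have copx: "coprime x y"
    by (rule coprimeI) (metis assms(3) dvd_diff dvd_mult dvd_mult2)
  have "x' * y = 1 + x * y'" using assms(3) by simp
  hence 1: "dedekind_sum x' y' = dedekind_sum y y'"
    using assms by (intro dedekind_sum_inverse) (metis mod_mult_self1)+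
  have "(- x) * y' = 1 + (- x') * y" using assms(3) by simp
  hence "dedekind_sum (- x) y = dedekind_sum y' y"
    using assms by (intro dedekind_sum_inverse) (metis mod_mult_self1)+
  hence 2: "dedekind_sum x y = - dedekind_sum y' y"
    using dedekind_sum_minus[OF assms(1) copx] by simp
  show ?thesis using dedekind_reciprocity[OF assms(1,2) cop] 1 2 by simp
qed

section \<open>Weighted row sums, and their evaluation along a unimodular chain\<close>

lemma sum_reflect_int:
  fixes l :: int and f :: "int \<Rightarrow> 'a::comm_monoid_add"
  shows "(\<Sum>y\<in>{1..<l}. f (l - y)) = (\<Sum>y\<in>{1..<l}. f y)"
  by (rule sum.reindex_bij_witness[where i = "\<lambda>y. l - y" and j = "\<lambda>y. l - y"]) auto

lemma sum_atLeast0_int: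
  fixes l :: int and f :: "int \<Rightarrow> real"
  assumes "f 0 = 0"
  shows "(\<Sum>y\<in>{0..<l}. f y) = (\<Sum>y\<in>{1..<l}. f y)"
  by (rule sum.mono_neutral_right) (use assms in \<open>auto simp: int_one_le_iff_zero_less not_le order.order_iff_strict\<close>)

text \<open>Reflection replaces \<open>(1 - \<rho>)^2 \<phi>\<close> by
  \<open>\<rho>^2 (1 - \<phi>)\<close>. The average of the two has no \<open>\<rho>^2 \<phi>\<close>
  term, and the remaining mixed term \<open>\<rho> \<phi>\<close> is the Dedekind sum. The sum of
  squares that is left does not depend on \<open>s\<close>.\<close>

lemma weighted_mod_sum:
  fixes s l :: int
  assumes "0 < l" "coprime s l"
  shows "2 * (\<Sum>y\<in>{1..<l}. (1 - of_int y / of_int l)\<^sup>2 * (of_int ((s * y) mod l) / of_int l))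
     = (\<Sum>y\<in>{1..<l}. (real_of_int y / of_int l)\<^sup>2) - 2 * dedekind_sum s l"
proof -
  define \<rho> where "\<rho> y = real_of_int y / of_int l" for y
  define \<phi> where "\<phi> y = real_of_int ((s * y) mod l) / of_int l" for y
  have refl: "\<phi> (l - y) = 1 - \<phi> y" "\<rho> (l - y) = 1 - \<rho> y" if y: "y \<in> {1..<l}" for y
  proof -
    have nd: "\<not> l dvd s * y"
    proof
      assume "l dvd s * y"
      hence "l dvd y" using assms(2) by (simp add: coprime_commute coprime_dvd_mult_right_iff)
      thus False using y zdvd_not_zless by auto
    qed
    have "(s * (l - y)) mod l = (- (s * y) + s * l) mod l" by (simp add: algebra_simps)
    also have "\<dots> = (- (s * y)) mod l" by (rule mod_mult_self1)
    also have "\<dots> = l - (s * y) mod l" using nd by (simp add: zmod_zminus1_eq_if dvd_eq_mod_eq_0)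
    finally show "\<phi> (l - y) = 1 - \<phi> y" using assms by (simp add: \<phi>_def field_simps)
    show "\<rho> (l - y) = 1 - \<rho> y" using assms by (simp add: \<rho>_def field_simps)
  qed
  have "(\<Sum>y\<in>{1..<l}. (1 - \<rho> y)\<^sup>2 * \<phi> y) = (\<Sum>y\<in>{1..<l}. (\<rho> y)\<^sup>2 * (1 - \<phi> y))"
    by (subst sum_reflect_int[symmetric]) (simp add: refl)
  hence "2 * (\<Sum>y\<in>{1..<l}. (1 - \<rho> y)\<^sup>2 * \<phi> y)
      = (\<Sum>y\<in>{1..<l}. (1 - \<rho> y)\<^sup>2 * \<phi> y + (\<rho> y)\<^sup>2 * (1 - \<phi> y))"
    by (simp add: sum.distrib)
  also have "\<dots> = (\<Sum>y\<in>{1..<l}. (\<rho> y)\<^sup>2) + (\<Sum>y\<in>{1..<l}. \<phi> y) - 2 * (\<Sum>y\<in>{1..<l}. \<rho> y * \<phi> y)"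
    by (simp add: sum_distrib_left sum_subtractf[symmetric] sum.distrib[symmetric] power2_eq_square algebra_simps)
  also have "(\<Sum>y\<in>{1..<l}. \<phi> y) = (\<Sum>y\<in>{0..<l}. real_of_int ((s * y) mod l)) / of_int l"
    by (subst sum_atLeast0_int) (auto simp: \<phi>_def sum_divide_distrib)
  also have "\<dots> = (of_int l - 1) / 2"
    using sum_mult_mod_permute[OF assms, of real_of_int] sum_int_powers(1)[OF assms(1)] assms(1)
    by (simp add: field_simps)
  also have "(\<Sum>y\<in>{1..<l}. \<rho> y * \<phi> y) = dedekind_sum s l + (of_int l - 1) / 4"
    unfolding dedekind_sum_def
    by (subst sum_atLeast0_int) (auto simp: \<phi>_def \<rho>_def sum_divide_distrib power2_eq_square)
  finally show ?thesis unfolding \<rho>_def \<phi>_def by simp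
qed

text \<open>Each quotient is its linear part minus a fractional part. The linear parts lead to the
  moment of \<open>(1 - \<rho>)^2 \<rho>\<close>, equal to \<open>(l - 1/l)/12\<close>; in the
  fractional parts the sums of squares from \<open>weighted_mod_sum\<close> agree for
  \<open>s\<close> and \<open>t\<close> and drop out.\<close>

lemma weighted_div_sum_diff:
  fixes s t l :: int
  assumes "0 < l" "coprime s l" "coprime t l"
  shows "12 * (\<Sum>y\<in>{1..<l}. (1 - of_int y / of_int l)\<^sup>2 * real_of_int ((s * y) div l - (t * y) div l))
     = of_int (s - t) * (of_int l - 1 / of_int l) + 12 * (dedekind_sum s l - dedekind_sum t l)"
proof -
  define \<rho> where "\<rho> y = real_of_int y / of_int l" for y
  define \<phi> where "\<phi> s y = real_of_int ((s * y) mod l) / of_int l" for s y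
  define L where "L = real_of_int l"
  have L: "L > 0" using assms by (simp add: L_def)
  have dv: "real_of_int ((s * y) div l) = of_int s * \<rho> y - \<phi> s y" for s y
    using assms(1) unfolding \<phi>_def \<rho>_def of_int_div_mod by (simp add: field_simps)
  have "(\<Sum>y\<in>{1..<l}. (1 - \<rho> y)\<^sup>2 * \<rho> y) = (\<Sum>y\<in>{1..<l}. \<rho> y - 2 * (\<rho> y)\<^sup>2 + \<rho> y ^ 3)"
    by (simp add: power2_eq_square power3_eq_cube algebra_simps)
  also have "\<dots> = (\<Sum>y\<in>{0..<l}. real_of_int y) / L - 2 * (\<Sum>y\<in>{0..<l}. (real_of_int y)\<^sup>2) / L^2
      + (\<Sum>y\<in>{0..<l}. real_of_int y ^ 3) / L^3"
    by (simp add: sum.distrib sum_subtractf sum_atLeast0_int sum_divide_distrib sum_distrib_left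
        \<rho>_def power_divide L_def)
  also have "(\<Sum>y\<in>{0..<l}. real_of_int y) = L * (L - 1) / 2"
    using sum_int_powers(1)[OF assms(1)] by (simp add: L_def)
  also have "(\<Sum>y\<in>{0..<l}. (real_of_int y)\<^sup>2) = L * (L - 1) * (2 * L - 1) / 6"
    using sum_int_powers(2)[OF assms(1)] by (simp add: L_def)
  also have "(\<Sum>y\<in>{0..<l}. real_of_int y ^ 3) = L^2 * (L - 1)^2 / 4"
    using sum_int_powers(3)[OF assms(1)] by (simp add: L_def)
  also have "L * (L - 1) / 2 / L - 2 * (L * (L - 1) * (2 * L - 1) / 6) / L^2 + L^2 * (L - 1)^2 / 4 / L^3
      = (L - 1 / L) / 12"
    using L by (simp add: field_simps power2_eq_square power3_eq_cube)
  finally have c: "(\<Sum>y\<in>{1..<l}. (1 - \<rho> y)\<^sup>2 * \<rho> y) = (L - 1 / L) / 12" .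
  have w: "2 * (\<Sum>y\<in>{1..<l}. (1 - \<rho> y)\<^sup>2 * \<phi> r y) = (\<Sum>y\<in>{1..<l}. (\<rho> y)\<^sup>2) - 2 * dedekind_sum r l"
    if "coprime r l" for r
    using weighted_mod_sum[OF assms(1) that] by (simp add: \<rho>_def \<phi>_def)
  have "(\<Sum>y\<in>{1..<l}. (1 - \<rho> y)\<^sup>2 * real_of_int ((s * y) div l - (t * y) div l))
     = of_int (s - t) * (\<Sum>y\<in>{1..<l}. (1 - \<rho> y)\<^sup>2 * \<rho> y)
       - (\<Sum>y\<in>{1..<l}. (1 - \<rho> y)\<^sup>2 * \<phi> s y) + (\<Sum>y\<in>{1..<l}. (1 - \<rho> y)\<^sup>2 * \<phi> t y)"
    unfolding of_int_diff dv
    by (simp add: sum_distrib_left sum_subtractf[symmetric] sum.distrib[symmetric] algebra_simps)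
  also have "\<dots> = of_int (s - t) * ((L - 1 / L) / 12) + dedekind_sum s l - dedekind_sum t l"
    unfolding c using w[OF assms(2)] w[OF assms(3)] by simp
  finally show ?thesis by (simp add: \<rho>_def L_def)
qed

text \<open>By the determinant condition \<open>1 / (y_i y_(i+1))\<close> is the difference of the
  slopes \<open>x_(i+1) / y_(i+1)\<close> and \<open>x_i / y_i\<close>, so these terms telescope to
  the two end slopes.\<close>

lemma dedekind_sum_unimodular_chain:
  fixes x y :: "nat \<Rightarrow> int"
  assumes "\<And>i. i \<le> k \<Longrightarrow> 0 < y i" "\<And>i. i < k \<Longrightarrow> x (Suc i) * y i - x i * y (Suc i) = 1"
  shows "12 * (dedekind_sum (x k) (y k) - dedekind_sum (x 0) (y 0))
       = (\<Sum>i<k. of_int (y i) / of_int (y (Suc i)) + of_int (y (Suc i)) / of_int (y i))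
         + of_int (x k) / of_int (y k) - of_int (x 0) / of_int (y 0) - 3 * of_nat k"
  using assms
proof (induction k)
  case (Suc k)
  have IH: "12 * (dedekind_sum (x k) (y k) - dedekind_sum (x 0) (y 0))
       = (\<Sum>i<k. of_int (y i) / of_int (y (Suc i)) + of_int (y (Suc i)) / of_int (y i))
         + of_int (x k) / of_int (y k) - of_int (x 0) / of_int (y 0) - 3 * of_nat k"
    by (rule Suc.IH) (use Suc.prems in auto)
  have u: "x (Suc k) * y k - x k * y (Suc k) = 1" and p: "0 < y k" "0 < y (Suc k)"
    using Suc.prems by auto
  have "real_of_int (x (Suc k)) * of_int (y k) - of_int (x k) * of_int (y (Suc k)) = 1"
    using u by (metis of_int_1 of_int_diff of_int_mult)
  hence "of_int (x (Suc k)) / of_int (y (Suc k)) - of_int (x k) / of_int (y k)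
      = 1 / (real_of_int (y k) * of_int (y (Suc k)))"
    using p by (simp add: field_simps)
  with dedekind_sum_unimodular_step[OF p u] IH show ?case by (simp add: algebra_simps)
qed simp

text \<open>Both ends of the chain have height \<open>l\<close>, so the end slopes contribute
  \<open>(x k - x 0) / l\<close>, which cancels the \<open>1/l\<close> part of
  \<open>weighted_div_sum_diff\<close>.\<close>

lemma weighted_sum_unimodular_chain:
  fixes x y a :: "nat \<Rightarrow> int" and l :: int
  assumes "0 < k" "y 0 = l" "y k = l"
    and pos: "\<And>i. i \<le> k \<Longrightarrow> 0 < y i"
    and unim: "\<And>i. i < k \<Longrightarrow> x (Suc i) * y i - x i * y (Suc i) = 1"
    and a: "\<And>i. 1 \<le> i \<Longrightarrow> i < k \<Longrightarrow> y (i - 1) + y (i + 1) = a i * y i"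
  shows "12 * (\<Sum>j\<in>{1..<l}. (1 - of_int j / of_int l)\<^sup>2 * real_of_int ((x k * j) div l - (x 0 * j) div l))
     = of_int (x k - x 0) * of_int l - of_nat k + (\<Sum>i\<in>{1..<k}. of_int (a i - 2) * (1 - of_int (y i) / of_int l))"
proof -
  have l: "0 < l" using pos[of 0] assms by simp
  obtain m where m: "k = Suc m" using assms(1) by (cases k) auto
  have co0: "coprime (x 0) l"
    by (rule coprimeI) (use unim[of 0] assms(1,2) in \<open>metis dvd_diff dvd_mult dvd_mult2\<close>)
  have cok: "coprime (x k) l"
    by (rule coprimeI) (use unim[of m] m assms(3) in \<open>metis dvd_diff dvd_mult dvd_mult2 lessI\<close>)
  define Y where "Y i = real_of_int (y i)" for i
  have Yp: "Y i > 0" if "i \<le> k" for i using pos[OF that] by (simp add: Y_def)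
  have Ya: "Y (i - 1) + Y (i + 1) = of_int (a i) * Y i" if "1 \<le> i" "i < k" for i
    using a[OF that] unfolding Y_def by (metis of_int_add of_int_mult)
  \<comment> \<open>Regrouping by denominators: each inner \<open>Y i\<close> collects both
    neighbours, hence \<open>a i\<close>; the two ends collect only one neighbour each.\<close>
  have split: "(\<Sum>i<k. Y i / Y (Suc i) + Y (Suc i) / Y i)
      = (Y 1 + Y m) / of_int l + (\<Sum>i\<in>{1..<k}. of_int (a i))"
  proof -
    have "(\<Sum>i<k. Y i / Y (Suc i)) = (\<Sum>i<m. Y i / Y (Suc i)) + Y m / of_int l"
      using assms(3) by (simp add: m Y_def)
    moreover have "(\<Sum>i<m. Y i / Y (Suc i)) = (\<Sum>i\<in>{1..<k}. Y (i - 1) / Y i)"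
      by (rule sum.reindex_bij_witness[where i = "\<lambda>i. i - 1" and j = Suc]) (auto simp: m)
    moreover have "(\<Sum>i<k. Y (Suc i) / Y i) = Y 1 / of_int l + (\<Sum>i\<in>{1..<k}. Y (i + 1) / Y i)"
    proof -
      have "{..<k} = insert 0 {1..<k}" using assms(1) by auto
      thus ?thesis using assms(2) by (simp add: Y_def)
    qed
    moreover have "(\<Sum>i\<in>{1..<k}. Y (i - 1) / Y i) + (\<Sum>i\<in>{1..<k}. Y (i + 1) / Y i) = (\<Sum>i\<in>{1..<k}. of_int (a i))"
      unfolding sum.distrib[symmetric]
    proof (rule sum.cong)
      fix i assume i: "i \<in> {1..<k}"
      have "Y (i - 1) / Y i + Y (i + 1) / Y i = (Y (i - 1) + Y (i + 1)) / Y i" by (simp add: add_divide_distrib)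
      also have "\<dots> = of_int (a i)" using Ya[of i] Yp[of i] i by simp
      finally show "Y (i - 1) / Y i + Y (i + 1) / Y i = of_int (a i)" .
    qed simp
    ultimately show ?thesis by (simp add: sum.distrib add_divide_distrib)
  qed
  define Z where "Z i = Y (i - 1) + Y (i + 1) - 2 * Y i" for i
  have tele: "(\<Sum>i\<in>{1..<Suc n}. Z i) = Y 0 - Y 1 + Y (Suc n) - Y n" for n
    by (induction n) (auto simp: Z_def)
  have "(\<Sum>i\<in>{1..<k}. of_int (a i - 2) * (1 - Y i / of_int l))
      = (\<Sum>i\<in>{1..<k}. of_int (a i) - 2 - Z i / of_int l)"
  proof (rule sum.cong)
    fix i assume "i \<in> {1..<k}"
    hence "Y (i - 1) + Y (i + 1) = of_int (a i) * Y i" using Ya[of i] by simp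
    thus "of_int (a i - 2) * (1 - Y i / of_int l) = of_int (a i) - 2 - Z i / of_int l"
      unfolding Z_def by (simp only:) (simp add: algebra_simps diff_divide_distrib)
  qed simp
  also have "\<dots> = (\<Sum>i\<in>{1..<k}. of_int (a i)) - 2 * (real k - 1) - (Y 0 - Y 1 + Y (Suc m) - Y m) / of_int l"
    unfolding sum_subtractf sum_divide_distrib[symmetric] unfolding m tele by simp
  \<comment> \<open>\<open>(Y 0 + Y (Suc m)) / l = 2\<close> makes up for the \<open>k - 1\<close>
    in place of \<open>k\<close>.\<close>
  also have "\<dots> = (\<Sum>i\<in>{1..<k}. of_int (a i)) - 2 * real k + (Y 1 + Y m) / of_int l"
    using l assms(2,3) m by (simp add: Y_def field_simps)
  finally have r: "(\<Sum>i\<in>{1..<k}. of_int (a i - 2) * (1 - Y i / of_int l))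
      = (\<Sum>i\<in>{1..<k}. of_int (a i)) - 2 * real k + (Y 1 + Y m) / of_int l" .
  have "12 * (dedekind_sum (x k) l - dedekind_sum (x 0) l)
      = (Y 1 + Y m) / of_int l + (\<Sum>i\<in>{1..<k}. of_int (a i)) + of_int (x k - x 0) / of_int l - 3 * of_nat k"
    using dedekind_sum_unimodular_chain[of k y x, OF pos unim] split assms(2,3)
    by (simp add: Y_def diff_divide_distrib)
  moreover have "real_of_int (x k - x 0) * (of_int l - 1 / of_int l) = of_int (x k - x 0) * of_int l - of_int (x k - x 0) / of_int l"
    by (simp add: right_diff_distrib)
  ultimately show ?thesis using weighted_div_sum_diff[OF l cok co0] r unfolding Y_def by linarith
qed

subsection \<open>Lattice triangles\<close>

lemma mem_convex_hull_0_2: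
  fixes p q :: "'a::real_vector"
  shows "x \<in> convex hull {0, p, q} \<longleftrightarrow> (\<exists>a b. 0 \<le> a \<and> 0 \<le> b \<and> a + b \<le> 1 \<and> x = a *\<^sub>R p + b *\<^sub>R q)"
proof
  assume "x \<in> convex hull {0, p, q}"
  then obtain u v w where "0 \<le> u" "0 \<le> v" "0 \<le> w" "u + v + w = 1" "x = u *\<^sub>R 0 + v *\<^sub>R p + w *\<^sub>R q"
    unfolding convex_hull_3 by blast
  thus "\<exists>a b. 0 \<le> a \<and> 0 \<le> b \<and> a + b \<le> 1 \<and> x = a *\<^sub>R p + b *\<^sub>R q"
    by (intro exI[of _ v] exI[of _ w]) auto
next
  assume "\<exists>a b. 0 \<le> a \<and> 0 \<le> b \<and> a + b \<le> 1 \<and> x = a *\<^sub>R p + b *\<^sub>R q"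
  then obtain a b where "0 \<le> a" "0 \<le> b" "a + b \<le> 1" "x = a *\<^sub>R p + b *\<^sub>R q" by blast
  thus "x \<in> convex hull {0, p, q}" unfolding convex_hull_3 mem_Collect_eq
    by (intro exI[of _ "1 - a - b"] exI[of _ a] exI[of _ b]) simp
qed

lemma mem_convex_cone_hull_2:
  fixes p q :: "'a::real_vector"
  shows "x \<in> convex_cone hull {p, q} \<longleftrightarrow> (\<exists>a b. 0 \<le> a \<and> 0 \<le> b \<and> x = a *\<^sub>R p + b *\<^sub>R q)"
proof
  let ?C = "{x. \<exists>a b. 0 \<le> a \<and> 0 \<le> b \<and> x = a *\<^sub>R p + b *\<^sub>R q}"
  have "convex_cone ?C" unfolding convex_cone_iff
  proof (intro conjI ballI allI impI)
    show "0 \<in> ?C" by (auto intro!: exI[of _ 0])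
    fix x y assume "x \<in> ?C" "y \<in> ?C"
    then obtain a b c d where "0 \<le> a" "0 \<le> b" "x = a *\<^sub>R p + b *\<^sub>R q" "0 \<le> c" "0 \<le> d" "y = c *\<^sub>R p + d *\<^sub>R q"
      by blast
    hence "0 \<le> a + c \<and> 0 \<le> b + d \<and> x + y = (a + c) *\<^sub>R p + (b + d) *\<^sub>R q"
      by (simp add: algebra_simps)
    thus "x + y \<in> ?C" by blast
  next
    fix x :: 'a and c :: real assume "x \<in> ?C" "0 \<le> c"
    then obtain a b where "0 \<le> a" "0 \<le> b" "x = a *\<^sub>R p + b *\<^sub>R q" by blast
    hence "0 \<le> c * a \<and> 0 \<le> c * b \<and> c *\<^sub>R x = (c * a) *\<^sub>R p + (c * b) *\<^sub>R q"
      using \<open>0 \<le> c\<close> by (simp add: algebra_simps)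
    thus "c *\<^sub>R x \<in> ?C" by blast
  qed
  moreover have "{p, q} \<subseteq> ?C"
  proof -
    have "p = 1 *\<^sub>R p + 0 *\<^sub>R q" "q = 0 *\<^sub>R p + 1 *\<^sub>R q" by simp_all
    thus ?thesis using zero_le_one[where 'a = real] order_refl[of "0::real"] by blast
  qed
  moreover assume "x \<in> convex_cone hull {p, q}"
  ultimately show "\<exists>a b. 0 \<le> a \<and> 0 \<le> b \<and> x = a *\<^sub>R p + b *\<^sub>R q"
    using hull_minimal[of "{p, q}" ?C convex_cone] by blast
next
  assume "\<exists>a b. 0 \<le> a \<and> 0 \<le> b \<and> x = a *\<^sub>R p + b *\<^sub>R q"
  thus "x \<in> convex_cone hull {p, q}"
    by (metis convex_cone_hull_add convex_cone_hull_mul hull_inc insertCI)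
qed

lemma convex_hull_halfspace_ge:
  fixes f :: "'a::real_vector \<Rightarrow> real"
  assumes "linear f" "\<And>z. z \<in> S \<Longrightarrow> c \<le> f z" "x \<in> convex hull S"
  shows "c \<le> f x"
proof -
  have "convex (f -` {c..})" by (intro convex_linear_vimage assms) simp
  hence "convex hull S \<subseteq> f -` {c..}" using assms(2) by (intro hull_minimal) auto
  thus ?thesis using assms(3) by auto
qed

definition cross2 :: "real^2 \<Rightarrow> real^2 \<Rightarrow> real" where
  "cross2 v w = v$1 * w$2 - v$2 * w$1"

lemma cross2_simps [simp]:
  "cross2 (a + b) c = cross2 a c + cross2 b c" "cross2 c (a + b) = cross2 c a + cross2 c b"
  "cross2 (a - b) c = cross2 a c - cross2 b c" "cross2 c (a - b) = cross2 c a - cross2 c b"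
  "cross2 (r *\<^sub>R a) c = r * cross2 a c" "cross2 c (r *\<^sub>R a) = r * cross2 c a"
  "cross2 0 c = 0" "cross2 c 0 = 0" "cross2 a a = 0"
  "cross2 (- a) c = - cross2 a c" "cross2 c (- a) = - cross2 c a"
  by (simp_all add: cross2_def algebra_simps)

lemma cross2_commute: "cross2 v w = - cross2 w v"
  by (simp add: cross2_def)

text \<open>Cramer's rule, cleared of denominators.\<close>

lemma cross2_expand: "cross2 p q *\<^sub>R x = cross2 x q *\<^sub>R p + cross2 p x *\<^sub>R q"
  by (simp add: cross2_def vec_eq_iff forall_2 algebra_simps)

text \<open>Normal form of the triangle: \<open>e1\<close> runs along the edge, \<open>l\<close> is
  the lattice height of the edge over the origin, and the coprimality conditions are primitivity of
  \<open>u1\<close> and \<open>u2\<close>. The conditions \<open>t < s\<close> and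
  \<open>0 < l\<close> already fix the signs of \<open>e1\<close> and \<open>e2\<close>, so the
  orientation of the basis has to stay open.\<close>

locale lattice_triangle =
  fixes N :: "(real^2) set" and e1 e2 u1 u2 :: "real^2" and s t l :: int
  assumes N_eq: "N = {of_int x *\<^sub>R e1 + of_int y *\<^sub>R e2 | x y. True}"
    and basis: "cross2 e1 e2 \<noteq> 0"
    and u1_eq: "u1 = of_int s *\<^sub>R e1 + of_int l *\<^sub>R e2"
    and u2_eq: "u2 = of_int t *\<^sub>R e1 + of_int l *\<^sub>R e2"
    and st: "t < s" and l_pos: "0 < l"
    and coprime_sl: "coprime s l" and coprime_tl: "coprime t l"
begin

text \<open>\<open>D\<close> is the determinant normalized so that \<open>D u2 u1\<close> is positive.\<close>

definition D :: "real^2 \<Rightarrow> real^2 \<Rightarrow> real" where "D v w = - cross2 v w / cross2 e1 e2"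

definition X :: "real^2 \<Rightarrow> real" where "X v = D e2 v"
definition Y :: "real^2 \<Rightarrow> real" where "Y v = D v e1"

lemma D_simps [simp]:
  "D (a + b) c = D a c + D b c" "D c (a + b) = D c a + D c b"
  "D (a - b) c = D a c - D b c" "D c (a - b) = D c a - D c b"
  "D (r *\<^sub>R a) c = r * D a c" "D c (r *\<^sub>R a) = r * D c a"
  "D 0 c = 0" "D c 0 = 0" "D a a = 0"
  by (simp_all add: D_def add_divide_distrib diff_divide_distrib)

lemma D_commute: "D v w = - D w v"
  unfolding D_def by (subst cross2_commute) simp

lemma D_e: "D e2 e1 = 1" "D e1 e2 = -1"
  using basis by (simp_all add: D_def) (subst cross2_commute, simp)

lemma D_expand: "D p q *\<^sub>R x = D x q *\<^sub>R p + D p x *\<^sub>R q"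
proof -
  have "D p q *\<^sub>R x = (- 1 / cross2 e1 e2) *\<^sub>R (cross2 p q *\<^sub>R x)" by (simp add: D_def)
  also have "\<dots> = D x q *\<^sub>R p + D p x *\<^sub>R q"
    unfolding cross2_expand[of p q x] by (simp add: D_def scaleR_add_right)
  finally show ?thesis .
qed

lemma D_expand_div:
  assumes "D p q \<noteq> 0"
  shows "x = (D x q / D p q) *\<^sub>R p + (D p x / D p q) *\<^sub>R q"
proof -
  have "(1 / D p q) *\<^sub>R (D p q *\<^sub>R x) = (1 / D p q) *\<^sub>R (D x q *\<^sub>R p + D p x *\<^sub>R q)"
    using D_expand[of p q x] by simp
  thus ?thesis using assms by (simp add: scaleR_add_right)
qed

lemma XY_simps [simp]:
  "X (a + b) = X a + X b" "X (a - b) = X a - X b" "X (r *\<^sub>R a) = r * X a" "X 0 = 0"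
  "Y (a + b) = Y a + Y b" "Y (a - b) = Y a - Y b" "Y (r *\<^sub>R a) = r * Y a" "Y 0 = 0"
  "X e1 = 1" "X e2 = 0" "Y e1 = 0" "Y e2 = 1"
  by (simp_all add: X_def Y_def D_e)

lemma XY_expand: "x = X x *\<^sub>R e1 + Y x *\<^sub>R e2"
  using D_expand_div[of e2 e1 x] by (simp add: D_e X_def Y_def add.commute)

lemma D_XY: "D v w = X w * Y v - X v * Y w"
proof -
  have "D v w = D (X v *\<^sub>R e1 + Y v *\<^sub>R e2) (X w *\<^sub>R e1 + Y w *\<^sub>R e2)"
    using XY_expand by metis
  also have "\<dots> = X w * Y v - X v * Y w" by (simp add: D_e)
  finally show ?thesis .
qed

lemma X_u [simp]: "X u1 = of_int s" "X u2 = of_int t" and Y_u [simp]: "Y u1 = of_int l" "Y u2 = of_int l"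
  by (simp_all add: u1_eq u2_eq)

lemma linear_XY: "linear X" "linear Y"
  by (intro linearI; simp)+

lemma mem_N: "v \<in> N \<longleftrightarrow> X v \<in> \<int> \<and> Y v \<in> \<int>"
proof
  assume "v \<in> N"
  then obtain x y where "v = of_int x *\<^sub>R e1 + of_int y *\<^sub>R e2" unfolding N_eq by blast
  thus "X v \<in> \<int> \<and> Y v \<in> \<int>" by simp
next
  assume "X v \<in> \<int> \<and> Y v \<in> \<int>"
  then obtain x y where "X v = of_int x" "Y v = of_int y" by (auto elim!: Ints_cases)
  thus "v \<in> N" using XY_expand[of v] unfolding N_eq by auto
qed

lemma D_Ints: "v \<in> N \<Longrightarrow> w \<in> N \<Longrightarrow> D v w \<in> \<int>"
  by (simp add: mem_N D_XY)

lemma u_in_N: "u1 \<in> N" "u2 \<in> N" by (simp_all add: mem_N)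

lemma D_u: "D u2 u1 = of_int l * of_int (s - t)" and D_u_pos: "D u2 u1 > 0"
  using st l_pos by (simp_all add: D_XY algebra_simps)

text \<open>\<open>u1 - u2\<close> is \<open>s - t\<close> times \<open>e1\<close>, and pairing
  \<open>x\<close> with \<open>e1\<close> gives \<open>Y x\<close>. Thus the barycentric weights at
  \<open>u1\<close> and \<open>u2\<close> add up to \<open>Y x / l\<close>.\<close>

lemma D_u_sum: "D u2 x + D x u1 = of_int (s - t) * Y x"
  by (simp add: D_XY algebra_simps)

abbreviation T where "T \<equiv> nabla u1 u2"

text \<open>\<open>D p x\<close> and \<open>D x q\<close> are the barycentric coordinates of
  \<open>x\<close> at \<open>q\<close> and \<open>p\<close>, multiplied by
  \<open>D p q\<close>.\<close>

lemma mem_triangle: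
  assumes "D p q > 0"
  shows "x \<in> convex hull {0, p, q} \<longleftrightarrow> 0 \<le> D p x \<and> 0 \<le> D x q \<and> D p x + D x q \<le> D p q"
proof
  assume "x \<in> convex hull {0, p, q}"
  then obtain a b where ab: "0 \<le> a" "0 \<le> b" "a + b \<le> 1" "x = a *\<^sub>R p + b *\<^sub>R q"
    unfolding mem_convex_hull_0_2 by blast
  have "a * D p q + b * D p q \<le> 1 * D p q" unfolding distrib_right[symmetric]
    using ab assms by (intro mult_right_mono) auto
  thus "0 \<le> D p x \<and> 0 \<le> D x q \<and> D p x + D x q \<le> D p q" using ab assms by simp
next
  assume "0 \<le> D p x \<and> 0 \<le> D x q \<and> D p x + D x q \<le> D p q"
  thus "x \<in> convex hull {0, p, q}" unfolding mem_convex_hull_0_2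
    using assms D_expand_div[of p q x]
    by (intro exI[of _ "D x q / D p q"] exI[of _ "D p x / D p q"]) (auto simp: field_simps)
qed

lemma mem_T: "x \<in> T \<longleftrightarrow> 0 \<le> D u2 x \<and> 0 \<le> D x u1 \<and> Y x \<le> of_int l"
proof -
  have "T = convex hull {0, u2, u1}" unfolding nabla_def by (simp add: insert_commute)
  moreover have "D u2 x + D x u1 \<le> D u2 u1 \<longleftrightarrow> Y x \<le> of_int l"
    unfolding D_u_sum D_u using st by (simp add: mult.commute)
  ultimately show ?thesis using mem_triangle[OF D_u_pos, of x] by simp
qed

lemma convex_T: "convex T" unfolding nabla_def by (rule convex_convex_hull)

lemma T_scale: "x \<in> T \<Longrightarrow> 0 \<le> c \<Longrightarrow> c \<le> 1 \<Longrightarrow> c *\<^sub>R x \<in> T"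
  using convexD[OF convex_T, of x 0 c "1 - c"] by (simp add: nabla_def hull_inc)

lemma Y_nonneg: "0 \<le> D u2 x \<Longrightarrow> 0 \<le> D x u1 \<Longrightarrow> 0 \<le> Y x"
  using D_u_sum[of x] st by (smt (verit) of_int_0_less_iff mult_pos_neg)

lemma eq_0_if_Y_le_0:
  assumes "0 \<le> D u2 x" "0 \<le> D x u1" "Y x \<le> 0"
  shows "x = 0"
proof -
  have "of_int (s - t) * Y x \<le> 0" using st assms(3) by (simp add: mult_nonneg_nonpos)
  hence "D u2 x = 0" "D x u1 = 0" using D_u_sum[of x] assms by linarith+
  thus ?thesis using D_expand_div[of u2 u1 x] D_u_pos by simp
qed

text \<open>\<open>B\<close> describes the nonzero lattice points of the closed sail without a closure, see
  \<open>closure_sail_lattice\<close>.\<close>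

definition Z where "Z = T \<inter> N - {0}"
definition Q where "Q = convex hull Z"
definition B where "B = {p \<in> Z. \<forall>c. 0 \<le> c \<and> c < 1 \<longrightarrow> c *\<^sub>R p \<notin> Q}"

lemma B_Z: "p \<in> B \<Longrightarrow> p \<in> Z" by (simp add: B_def)
lemma Z_Q: "p \<in> Z \<Longrightarrow> p \<in> Q" by (simp add: Q_def hull_inc)
lemma B_Q: "p \<in> B \<Longrightarrow> p \<in> Q" using B_Z Z_Q by blast
lemma convex_Q: "convex Q" unfolding Q_def by (rule convex_convex_hull)
lemma Q_T: "x \<in> Q \<Longrightarrow> x \<in> T"
  using hull_minimal[of Z T convex] convex_T unfolding Q_def Z_def by blast

section \<open>The hull \<open>Q\<close> of the nonzero lattice points, and its minimal points
  \<open>B\<close>\<close>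

lemma Q_ge:
  fixes f :: "real^2 \<Rightarrow> real"
  assumes "linear f" "\<And>z. z \<in> Z \<Longrightarrow> c \<le> f z" "x \<in> Q"
  shows "c \<le> f x"
  by (rule convex_hull_halfspace_ge[of f Z]) (use assms in \<open>auto simp: Q_def\<close>)

lemma u_Z: "u1 \<in> Z" "u2 \<in> Z"
proof -
  have "u1 \<noteq> 0" "u2 \<noteq> 0" using D_u_pos by auto
  thus "u1 \<in> Z" "u2 \<in> Z" using D_u_pos u_in_N by (auto simp: Z_def mem_T)
qed

lemma Z_Y_ge_1:
  assumes "z \<in> Z"
  shows "1 \<le> Y z"
proof -
  have "0 < Y z" using assms eq_0_if_Y_le_0[of z] by (force simp: Z_def mem_T not_le[symmetric])
  moreover obtain y where "Y z = of_int y" using assms by (auto simp: Z_def mem_N elim: Ints_cases)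
  ultimately show ?thesis by simp
qed

lemma Q_Y_ge_1: "x \<in> Q \<Longrightarrow> 1 \<le> Y x"
  by (rule Q_ge[OF linear_XY(2) Z_Y_ge_1])

lemma Q_nonzero: "0 \<notin> Q" using Q_Y_ge_1[of 0] by auto

text \<open>Heights lie between 0 and \<open>l\<close>, and \<open>x / y\<close> lies between
  \<open>t / l\<close> and \<open>s / l\<close>. Finiteness is used for the compactness of
  \<open>Q\<close> and for the choice of a minimizing lattice point.\<close>

lemma finite_Z: "finite Z"
proof -
  have "Z \<subseteq> (\<lambda>(x, y). of_int x *\<^sub>R e1 + of_int y *\<^sub>R e2) ` ({-\<bar>t\<bar>..\<bar>s\<bar>} \<times> {0..l})"
  proof
    fix z assume z: "z \<in> Z"
    obtain x y where xy: "X z = of_int x" "Y z = of_int y"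
      using z by (auto simp: Z_def mem_N elim!: Ints_cases)
    have T: "0 \<le> D u2 z" "0 \<le> D z u1" "Y z \<le> of_int l" using z by (auto simp: Z_def mem_T)
    have "real_of_int (x * l) \<ge> of_int (t * y)" "real_of_int (s * y) \<ge> of_int (x * l)"
      using T(1,2) by (simp_all add: D_XY xy)
    hence 1: "t * y \<le> x * l" "x * l \<le> s * y" by linarith+
    have 2: "0 \<le> y" "y \<le> l" using T Y_nonneg[OF T(1,2)] by (simp_all add: xy)
    have "s * y \<le> \<bar>s\<bar> * l" using 2 by (intro order.trans[OF _ mult_left_mono[of y l "\<bar>s\<bar>"]] mult_right_mono) auto
    hence "x * l \<le> \<bar>s\<bar> * l" using 1 by linarith
    moreover have "- (\<bar>t\<bar> * l) \<le> - (\<bar>t\<bar> * y)" using 2 by (simp add: mult_left_mono)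
    hence "- (\<bar>t\<bar> * l) \<le> t * y" using 2 mult_right_mono[of "- \<bar>t\<bar>" t y] abs_ge_minus_self[of t] by simp
    hence "(- \<bar>t\<bar>) * l \<le> x * l" using 1 by simp
    ultimately have "x \<le> \<bar>s\<bar>" "- \<bar>t\<bar> \<le> x" using l_pos by (simp_all only: mult_le_cancel_right)
    thus "z \<in> (\<lambda>(x, y). of_int x *\<^sub>R e1 + of_int y *\<^sub>R e2) ` ({-\<bar>t\<bar>..\<bar>s\<bar>} \<times> {0..l})"
      using 2 XY_expand[of z] by (intro image_eqI[where x = "(x, y)"]) (auto simp: xy)
  qed
  thus ?thesis by (rule finite_subset) auto
qed

text \<open>The ray through \<open>y\<close> leaves the triangle at a point \<open>e\<close> of the
  edge, and the edge lies in \<open>Q\<close>; so \<open>Q\<close> contains the whole segment from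
  \<open>y\<close> to \<open>e\<close>.\<close>

lemma Q_upward:
  assumes "y \<in> Q" "1 \<le> c" "c *\<^sub>R y \<in> T"
  shows "c *\<^sub>R y \<in> Q"
proof -
  define \<eta> where "\<eta> = Y y"
  have \<eta>: "1 \<le> \<eta>" "c * \<eta> \<le> of_int l" using Q_Y_ge_1[OF assms(1)] assms(3) by (auto simp: \<eta>_def mem_T)
  define e where "e = (of_int l / \<eta>) *\<^sub>R y"
  have "e \<in> convex hull {u2, u1}"
  proof -
    have yT: "y \<in> T" using assms(1) Q_T by blast
    have "e = (D e u1 / D u2 u1) *\<^sub>R u2 + (D u2 e / D u2 u1) *\<^sub>R u1"
      by (rule D_expand_div) (use D_u_pos in simp)
    moreover have "D e u1 / D u2 u1 \<ge> 0" "D u2 e / D u2 u1 \<ge> 0"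
      using D_u_pos yT \<eta> l_pos by (auto simp: e_def mem_T)
    moreover have "D e u1 + D u2 e = D u2 u1"
      using D_u_sum[of e] \<eta> by (simp add: D_u e_def \<eta>_def[symmetric] mult.commute del: D_simps)
    hence "D e u1 / D u2 u1 + D u2 e / D u2 u1 = 1"
      using D_u_pos by (simp add: add_divide_distrib[symmetric] del: D_simps)
    ultimately show ?thesis unfolding convex_hull_2 by blast
  qed
  hence eQ: "e \<in> Q" using u_Z hull_mono[of "{u2, u1}" Z convex] unfolding Q_def by blast
  show ?thesis
  proof (cases "c = 1")
    case False
    hence c: "c > 1" using assms by simp
    define L where "L = real_of_int l / \<eta>"
    have L: "c \<le> L" using \<eta> by (simp add: L_def field_simps)
    have "c *\<^sub>R y = ((L - c) / (L - 1)) *\<^sub>R y + ((c - 1) / (L - 1)) *\<^sub>R e"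
    proof -
      have "(L - c) / (L - 1) + (c - 1) / (L - 1) * L = (c * (L - 1)) / (L - 1)"
        by (simp add: add_divide_distrib[symmetric] algebra_simps)
      also have "\<dots> = c" using c L by simp
      finally have "(L - c) / (L - 1) + (c - 1) / (L - 1) * L = c" .
      thus ?thesis by (simp add: e_def L_def[symmetric] scaleR_add_left[symmetric])
    qed
    moreover have "(L - c) / (L - 1) + (c - 1) / (L - 1) = 1"
      using c L by (simp add: add_divide_distrib[symmetric])
    ultimately show ?thesis using convexD[OF convex_Q assms(1) eQ, of "(L - c) / (L - 1)" "(c - 1) / (L - 1)"] c L
      by simp
  qed (use assms in simp)
qed

text \<open>Write \<open>z = \<beta> p + \<alpha> p'\<close> with \<open>\<alpha> <= 0\<close>. The
  segment from \<open>z\<close> to \<open>p'\<close> meets the line of \<open>p\<close> at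
  \<open>c p\<close> with \<open>c = \<beta> / (1 - \<alpha>)\<close>, the weights being chosen to
  cancel \<open>p'\<close>. This point lies in \<open>Q\<close>, and membership of \<open>p\<close>
  in \<open>B\<close> excludes \<open>c < 1\<close>.\<close>

lemma outside_cone:
  assumes "p \<in> B" "p' \<in> B" "D p p' \<noteq> 0" "z \<in> Q" "D p z / D p p' \<le> 0"
  shows "1 \<le> D p z / D p p' + D z p' / D p p'"
proof (rule ccontr)
  define \<alpha> \<beta> where "\<alpha> = D p z / D p p'" and "\<beta> = D z p' / D p p'"
  assume "\<not> ?thesis"
  hence lt: "\<alpha> + \<beta> < 1" by (simp add: \<alpha>_def \<beta>_def)
  have \<alpha>: "\<alpha> \<le> 0" using assms by (simp add: \<alpha>_def)
  have z: "z = \<beta> *\<^sub>R p + \<alpha> *\<^sub>R p'" unfolding \<alpha>_def \<beta>_def by (rule D_expand_div[OF assms(3)])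
  define c where "c = \<beta> / (1 - \<alpha>)"
  have "(1 / (1 - \<alpha>)) *\<^sub>R z + (- \<alpha> / (1 - \<alpha>)) *\<^sub>R p' \<in> Q"
    using \<alpha> by (intro convexD[OF convex_Q assms(4) B_Q[OF assms(2)]]) (auto simp: field_simps)
  also have "(1 / (1 - \<alpha>)) *\<^sub>R z + (- \<alpha> / (1 - \<alpha>)) *\<^sub>R p' = c *\<^sub>R p"
    unfolding z c_def by (simp add: scaleR_add_right scaleR_add_left[symmetric])
  finally have cQ: "c *\<^sub>R p \<in> Q" .
  have "c < 1" using lt \<alpha> by (simp add: c_def field_simps)
  moreover have "0 \<le> c"
  proof (rule ccontr)
    assume "\<not> 0 \<le> c"
    hence "c * Y p \<le> 0" using Z_Y_ge_1[OF B_Z[OF assms(1)]] by (simp add: mult_nonpos_nonneg)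
    thus False using Q_Y_ge_1[OF cQ] by simp
  qed
  ultimately show False using assms(1) cQ unfolding B_def by blast
qed

lemma B_multiple:
  assumes "p \<in> B" "q \<in> Z" "q = c *\<^sub>R p"
  shows "1 \<le> c"
proof (rule ccontr)
  assume "\<not> 1 \<le> c"
  moreover have "0 \<le> c"
  proof (rule ccontr)
    assume "\<not> 0 \<le> c"
    hence "c * Y p \<le> 0" using Z_Y_ge_1[OF B_Z[OF assms(1)]] by (simp add: mult_nonpos_nonneg)
    thus False using Z_Y_ge_1[OF assms(2)] assms(3) by simp
  qed
  moreover have "c *\<^sub>R p \<in> Q" using Z_Q assms by blast
  ultimately show False using assms(1) unfolding B_def by auto
qed

text \<open>Dividing \<open>p\<close> by the gcd of its coordinates gives a lattice point of the
  triangle on the same ray, so \<open>B_multiple\<close> forces the gcd to be 1; \<open>q\<close> is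
  then built from Bezout coefficients.\<close>

lemma B_primitive:
  assumes "p \<in> B"
  obtains q where "q \<in> N" "D p q = 1"
proof -
  obtain a b where ab: "X p = of_int a" "Y p = of_int b"
    using B_Z[OF assms] by (auto simp: Z_def mem_N elim!: Ints_cases)
  have b: "1 \<le> b" using Z_Y_ge_1[OF B_Z[OF assms]] ab by simp
  define g where "g = gcd a b"
  have g: "1 \<le> g" using b by (simp add: g_def int_one_le_iff_zero_less)
  obtain a' b' where a': "a = g * a'" "b = g * b'" unfolding g_def by (meson dvdE gcd_dvd1 gcd_dvd2)
  define w where "w = (1 / of_int g) *\<^sub>R p"
  have "w \<in> N" using g by (simp add: w_def mem_N ab a')
  moreover have "w \<in> T" using B_Z[OF assms] T_scale[of p "1 / of_int g"] g by (simp add: Z_def w_def)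
  moreover have "w \<noteq> 0" using g B_Z[OF assms] by (simp add: w_def Z_def)
  ultimately have "w \<in> Z" by (simp add: Z_def)
  hence "1 \<le> 1 / real_of_int g" by (rule B_multiple[OF assms _ w_def])
  hence "g = 1" using g by (simp add: field_simps)
  then obtain u v where uv: "u * a + v * b = 1" unfolding g_def using bezout_int[of a b] by auto
  define q where "q = of_int v *\<^sub>R e1 + of_int (- u) *\<^sub>R e2"
  have "q \<in> N" by (simp add: mem_N q_def)
  moreover have "D p q = real_of_int (u * a + v * b)" by (simp add: D_XY q_def ab)
  ultimately show ?thesis using that uv by simp
qed

text \<open>A lattice point of the triangle \<open>0, p, p'\<close> that minimizes the functional equal to 1 at \<open>p\<close> and \<open>p'\<close>
  would lie in \<open>B\<close>, because the functional is at least 1 on the part of \<open>Q\<close> outside the cone.\<close>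

lemma consecutive:
  assumes p: "p \<in> B" and p': "p' \<in> B" and pos: "D p p' > 0"
    and none: "\<And>b. b \<in> B \<Longrightarrow> \<not> (D p b > 0 \<and> D b p' > 0)"
  shows consecutive_ge: "\<And>z. z \<in> Z \<Longrightarrow> D p p' \<le> D p z + D z p'"
    and consecutive_unimodular: "D p p' = 1"
proof -
  define h where "h z = D p z + D z p'" for z
  have lin: "linear h" unfolding h_def by (intro linearI) (simp_all add: algebra_simps)
  have out: "D p p' \<le> h z" if "z \<in> Z" "\<not> (D p z > 0 \<and> D z p' > 0)" for z
  proof -
    have "1 \<le> D p z / D p p' + D z p' / D p p'"
    proof (cases "D p z > 0")
      case False
      thus ?thesis using that pos by (intro outside_cone p p' Z_Q) (auto simp: divide_nonpos_pos)
    next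
      \<comment> \<open>Here \<open>z\<close> lies beyond the ray of \<open>p'\<close>, so
        \<open>outside_cone\<close> is applied with \<open>p\<close> and \<open>p'\<close>
        interchanged.\<close>
      case True
      hence "D z p' \<le> 0" using that by simp
      hence "1 \<le> D p' z / D p' p + D z p / D p' p"
        using pos that by (intro outside_cone p p' Z_Q) (auto simp: D_commute[of p' p] D_commute[of p' z] divide_nonpos_pos)
      thus ?thesis by (simp add: D_commute[of p' p] D_commute[of p' z] D_commute[of z p])
    qed
    thus ?thesis using pos by (simp add: h_def add_divide_distrib[symmetric])
  qed
  have inside: "D p p' < h z" if z: "z \<in> Z" "D p z > 0" "D z p' > 0" for z
  proof (rule ccontr)
    \<comment> \<open>Because of the bound \<open>h n <= D p p'\<close>, a minimizer over
      \<open>E\<close> also minimizes \<open>h\<close> over \<open>Z\<close>: outside the open cone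
      \<open>h\<close> is at least \<open>D p p'\<close> by \<open>out\<close>.\<close>
    define E where "E = {n \<in> Z. D p n > 0 \<and> D n p' > 0 \<and> h n \<le> D p p'}"
    assume "\<not> ?thesis"
    hence "z \<in> E" using z by (simp add: E_def)
    moreover have fin: "finite E" using finite_Z by (simp add: E_def)
    ultimately have "Min (h ` E) \<in> h ` E" by (intro Min_in) auto
    then obtain n where n: "n \<in> E" "Min (h ` E) = h n" by blast
    have nmin: "h n \<le> h m" if "m \<in> E" for m using n(2) fin that by (metis Min_le finite_imageI imageI)
    have "h n \<le> h m" if "m \<in> Z" for m
    proof (cases "m \<in> E")
      case False
      thus ?thesis using that out[of m] n(1) by (force simp: E_def)
    qed (rule nmin)
    hence Qge: "h n \<le> h x" if "x \<in> Q" for x using Q_ge[OF lin _ that] by blast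
    have hn: "0 < h n" using n(1) by (simp add: E_def h_def)
    have "c *\<^sub>R n \<notin> Q" if "c < 1" for c
    proof
      assume "c *\<^sub>R n \<in> Q"
      hence "h n \<le> c * h n" using Qge[of "c *\<^sub>R n"] by (simp add: h_def distrib_left)
      thus False using hn that by simp
    qed
    hence "n \<in> B" using n(1) by (simp add: B_def E_def)
    thus False using none n(1) by (auto simp: E_def)
  qed
  show "D p p' \<le> D p z + D z p'" if "z \<in> Z" for z
    using out[OF that] inside[OF that] unfolding h_def by linarith
  show "D p p' = 1"
  proof -
    obtain q0 where q0: "q0 \<in> N" "D p q0 = 1" using B_primitive[OF p] .
    have pN: "p \<in> N" "p' \<in> N" using B_Z p p' by (auto simp: Z_def)
    obtain d m where d: "D p p' = of_int d" and m: "D q0 p' = of_int m"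
      using D_Ints[OF pN] D_Ints[OF q0(1) pN(2)] by (auto elim!: Ints_cases)
    have d1: "1 \<le> d" using pos d by simp
    \<comment> \<open>Subtracting a multiple of \<open>p\<close> preserves \<open>D p q = 1\<close>
      and reduces \<open>D q p'\<close> to a residue modulo \<open>d\<close>, at most
      \<open>d - 1\<close>. This places \<open>q\<close> in the triangle
      \<open>0, p, p'\<close>.\<close>
    define q where "q = q0 - of_int (m div d) *\<^sub>R p"
    have qN: "q \<in> N" using q0(1) pN(1) by (simp add: q_def mem_N)
    have Dpq: "D p q = 1" by (simp add: q_def q0)
    have "D q p' = of_int (m - (m div d) * d)" by (simp add: q_def m d)
    hence Dqp': "D q p' = of_int (m mod d)" by (simp add: minus_div_mult_eq_mod)
    hence Dq: "0 \<le> D q p'" "1 + D q p' \<le> D p p'" using d1 pos_mod_bound[of d m] by (simp, unfold d Dqp') linarith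
    have "q \<in> convex hull {0, p, p'}" using Dpq Dq mem_triangle[OF pos] by simp
    moreover have "convex hull {0, p, p'} \<subseteq> T"
      using B_Z p p' by (intro hull_minimal convex_T) (auto simp: Z_def nabla_def hull_inc)
    moreover have "q \<noteq> 0" using Dpq by auto
    ultimately have qZ: "q \<in> Z" using qN by (auto simp: Z_def)
    \<comment> \<open>Either \<open>q\<close> is \<open>p'\<close> divided by \<open>d\<close>, and
      minimality of \<open>p'\<close> on its ray gives \<open>d = 1\<close>; or \<open>q\<close> is
      in the open cone with \<open>h q <= D p p'\<close>, against \<open>inside\<close>.\<close>
    show ?thesis
    proof (cases "D q p' = 0")
      case True
      hence "q = (1 / D p p') *\<^sub>R p'" using D_expand_div[of p p' q] pos Dpq by simp
      from B_multiple[OF p' qZ this] show ?thesis using Dq True by simp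
    next
      case False
      thus ?thesis using inside[OF qZ] Dpq Dq unfolding h_def by simp
    qed
  qed
qed

end

section \<open>Areas, the closure of the sail, interior points by rows, and the dual lattice\<close>

lemma cross2_triangle_area:
  "measure lebesgue (convex hull {a, b, c}) = \<bar>cross2 (b - a) (c - a)\<bar> / 2"
proof -
  have "compact (convex hull {a, b, c})" by (intro finite_imp_compact_convex_hull) auto
  hence "measure lebesgue (convex hull {a, b, c}) = measure lborel (convex hull {a, b, c})"
    by (intro measure_completion) (auto dest: compact_imp_closed)
  also have "\<dots> = \<bar>cross2 (b - a) (c - a)\<bar> / 2"
    unfolding content_triangle by (simp add: cross2_def abs_minus_commute mult.commute)
  finally show ?thesis .
qed

lemma independent_if_cross2:
  assumes "cross2 a b \<noteq> 0"
  shows "a \<noteq> b" "independent {a, b}"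
proof -
  show ab: "a \<noteq> b" using assms by auto
  have "b \<noteq> 0" using assms by auto
  moreover have "a \<notin> span {b}" using assms by (auto simp: span_singleton)
  ultimately show "independent {a, b}" using ab by (simp add: independent_insert)
qed

lemma inner_eq_unique:
  assumes "cross2 a b \<noteq> 0" "m \<bullet> a = m' \<bullet> a" "m \<bullet> b = m' \<bullet> b"
  shows "m = m'"
proof -
  have "(m - m') \<bullet> x = 0" for x
  proof -
    have "cross2 a b * ((m - m') \<bullet> x) = (m - m') \<bullet> (cross2 a b *\<^sub>R x)" by simp
    also have "\<dots> = 0" unfolding cross2_expand[of a b x] using assms by (simp add: inner_simps)
    finally show ?thesis using assms by simp
  qed
  from this[of "m - m'"] show ?thesis by simp
qed

context lattice_triangle
begin

lemma XY_eqI: "X a = X b \<Longrightarrow> Y a = Y b \<Longrightarrow> a = b"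
  using XY_expand by metis

text \<open>By coprimality \<open>u1\<close> and \<open>u2\<close> are the first nonzero lattice
  points on their rays.\<close>

lemma ray_ge:
  assumes "z \<in> Z" "D u2 z = 0 \<or> D z u1 = 0"
  shows "of_int l \<le> Y z"
proof -
  obtain x y where xy: "X z = of_int x" "Y z = of_int y"
    using assms(1) by (auto simp: Z_def mem_N elim!: Ints_cases)
  have y: "1 \<le> y" using Z_Y_ge_1[OF assms(1)] xy by simp
  have "real_of_int (x * l) = of_int (t * y) \<or> real_of_int (x * l) = of_int (s * y)"
    using assms(2) by (auto simp: D_XY xy mult.commute)
  hence "x * l = t * y \<or> x * l = s * y" by linarith
  hence "l dvd y"
  proof
    assume "x * l = t * y"
    hence "l dvd t * y" by (metis dvd_triv_right)
    thus ?thesis using coprime_tl by (simp add: coprime_commute coprime_dvd_mult_right_iff)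
  next
    assume "x * l = s * y"
    hence "l dvd s * y" by (metis dvd_triv_right)
    thus ?thesis using coprime_sl by (simp add: coprime_commute coprime_dvd_mult_right_iff)
  qed
  hence "l \<le> y" using y zdvd_imp_le by auto
  thus ?thesis by (simp add: xy)
qed

lemma D_Z_ge_1:
  assumes "z \<in> Z"
  shows "D u2 z = 0 \<or> 1 \<le> D u2 z" "D z u1 = 0 \<or> 1 \<le> D z u1"
proof -
  have zN: "z \<in> N" and "0 \<le> D u2 z" "0 \<le> D z u1" using assms by (auto simp: Z_def mem_T)
  moreover obtain a b where "D u2 z = of_int a" "D z u1 = of_int b"
    using D_Ints[OF u_in_N(2) zN] D_Ints[OF zN u_in_N(1)] by (auto elim!: Ints_cases)
  ultimately show "D u2 z = 0 \<or> 1 \<le> D u2 z" "D z u1 = 0 \<or> 1 \<le> D z u1" by auto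
qed

text \<open>The functional \<open>Y + l D u2\<close> is at least \<open>l\<close> on
  \<open>Z\<close>: a lattice point off the ray of \<open>u2\<close> has determinant at least 1, and
  one on the ray has height at least \<open>l\<close>. The bound passes to \<open>Q\<close>, and on
  the ray the functional is just \<open>Y\<close>. The ray of \<open>u1\<close> is treated
  alike.\<close>

lemma Q_ray_ge:
  assumes "x \<in> Q" "D u2 x = 0 \<or> D x u1 = 0"
  shows "of_int l \<le> Y x"
proof -
  define f g where "f z = Y z + of_int l * D u2 z" and "g z = Y z + of_int l * D z u1" for z
  have lin: "linear f" "linear g" unfolding f_def g_def by (intro linearI; simp add: algebra_simps)+
  have "of_int l \<le> f z \<and> of_int l \<le> g z" if z: "z \<in> Z" for z
  proof -
    have "Y z \<ge> 1" by (rule Z_Y_ge_1[OF z])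
    moreover have "real_of_int l * 1 \<le> of_int l * D u2 z" if "1 \<le> D u2 z"
      using that l_pos by (intro mult_left_mono) auto
    moreover have "real_of_int l * 1 \<le> of_int l * D z u1" if "1 \<le> D z u1"
      using that l_pos by (intro mult_left_mono) auto
    ultimately show ?thesis using D_Z_ge_1[OF z] ray_ge[OF z] unfolding f_def g_def by fastforce
  qed
  hence "of_int l \<le> f x \<and> of_int l \<le> g x"
    using Q_ge[OF lin(1) _ assms(1)] Q_ge[OF lin(2) _ assms(1)] by blast
  thus ?thesis using assms(2) unfolding f_def g_def by auto
qed

lemma compact_T: "compact T" unfolding nabla_def by (intro finite_imp_compact_convex_hull) auto

lemma compact_Q: "compact Q" unfolding Q_def by (intro finite_imp_compact_convex_hull finite_Z)

lemma continuous_D [continuous_intros]: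
  assumes "continuous_on S f" "continuous_on S g"
  shows "continuous_on S (\<lambda>x. D (f x) (g x))"
proof -
  have "continuous_on S (\<lambda>x. cross2 (f x) (g x))"
    unfolding cross2_def by (intro continuous_intros assms)
  thus ?thesis unfolding D_def using basis by (intro continuous_intros) auto
qed

lemma sail_eq: "sail N u1 u2 = T - Q"
  by (simp add: sail_def Q_def Z_def)

lemma B_in_closure:
  assumes "p \<in> B"
  shows "p \<in> closure (sail N u1 u2)"
  unfolding closure_sequential sail_eq
proof (intro exI conjI allI)
  show "(1 - inverse (real (Suc n))) *\<^sub>R p \<in> T - Q" for n
  proof -
    have c: "0 \<le> 1 - inverse (real (Suc n))" "1 - inverse (real (Suc n)) < 1" by (auto simp: field_simps)
    hence "(1 - inverse (real (Suc n))) *\<^sub>R p \<notin> Q" using assms unfolding B_def by blast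
    moreover have "p \<in> T" using assms by (simp add: B_def Z_def)
    ultimately show ?thesis using c T_scale by auto
  qed
  have "(\<lambda>n. (1 - inverse (real (Suc n))) *\<^sub>R p) \<longlonglongrightarrow> (1 - 0) *\<^sub>R p"
    by (intro tendsto_intros LIMSEQ_inverse_real_of_nat)
  thus "(\<lambda>n. (1 - inverse (real (Suc n))) *\<^sub>R p) \<longlonglongrightarrow> p" by simp
qed

text \<open>For the inclusion into \<open>B\<close>, suppose \<open>q = c p\<close> lies in
  \<open>Q\<close> with \<open>c < 1\<close>. Then \<open>q\<close> is below the edge, hence off
  both boundary rays, and the triangle \<open>u2, u1, q\<close> inside \<open>Q\<close> contains a
  neighbourhood of \<open>p\<close> relative to \<open>T\<close>. So \<open>p\<close> cannot be a
  limit of points of \<open>T - Q\<close>.\<close>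

lemma closure_sail_lattice: "closure (sail N u1 u2) \<inter> N - {0} = B"
proof (intro equalityI subsetI)
  fix p assume "p \<in> B"
  thus "p \<in> closure (sail N u1 u2) \<inter> N - {0}" using B_in_closure B_Z by (auto simp: Z_def)
next
  fix p assume p: "p \<in> closure (sail N u1 u2) \<inter> N - {0}"
  have "closure (T - Q) \<subseteq> T" by (intro closure_minimal compact_imp_closed compact_T) auto
  hence pT: "p \<in> T" using p by (auto simp: sail_eq)
  hence pZ: "p \<in> Z" using p by (simp add: Z_def)
  have "c *\<^sub>R p \<notin> Q" if c: "0 \<le> c" "c < 1" for c
  proof
    assume cQ: "c *\<^sub>R p \<in> Q"
    have Yp: "Y p \<le> of_int l" "1 \<le> Y p" using pT Z_Y_ge_1[OF pZ] by (auto simp: mem_T)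
    have c0: "0 < c" using cQ Q_nonzero c by (cases "c = 0") auto
    define q where "q = c *\<^sub>R p"
    have "c * Y p < 1 * Y p" using c Yp by (intro mult_strict_right_mono) auto
    moreover have "Y q = c * Y p" by (simp add: q_def)
    ultimately have Yq: "Y q < of_int l" using Yp by linarith
    have int: "0 < D u2 p" "0 < D p u1"
    proof -
      have "D u2 p \<noteq> 0 \<and> D p u1 \<noteq> 0" using Q_ray_ge[OF cQ] Yq by (auto simp: q_def)
      thus "0 < D u2 p" "0 < D p u1" using pT by (auto simp: mem_T)
    qed
    \<comment> \<open>Barycentric coordinates of \<open>x\<close> at \<open>u2\<close> and
      \<open>u1\<close> in the triangle \<open>u2, u1, q\<close>, multiplied by \<open>W\<close>. On
      \<open>T\<close> the coordinate at \<open>q\<close> is automatically nonnegative, since this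
      amounts to \<open>Y x <= l\<close>; two strict inequalities thus describe a relatively open
      part of \<open>Q\<close>.\<close>
    define A1 A2 where "A1 x = D x u1 - D x q - D q u1" and "A2 x = D u2 x - D q x - D u2 q" for x
    define W where "W = D u2 u1 - D q u1 - D u2 q"
    have W: "W = of_int (s - t) * (of_int l - Y q)"
      using D_u_sum[of q] D_u unfolding W_def by (simp add: algebra_simps)
    have Wpos: "W > 0" unfolding W using st Yq by simp
    have in_Q: "x \<in> Q" if x: "x \<in> T" "A1 x > 0" "A2 x > 0" for x
    proof -
      have "A1 x + A2 x = of_int (s - t) * (Y x - Y q)"
        using D_u_sum[of x] D_u_sum[of q] D_commute[of x q] unfolding A1_def A2_def right_diff_distrib by linarith
      also have "\<dots> \<le> W" unfolding W using st x(1) by (intro mult_left_mono) (auto simp: mem_T)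
      finally have le: "A1 x + A2 x \<le> W" .
      have "W *\<^sub>R x = A1 x *\<^sub>R u2 + A2 x *\<^sub>R u1 + (W - A1 x - A2 x) *\<^sub>R q"
        by (rule XY_eqI) (simp_all add: W_def A1_def A2_def D_XY algebra_simps)
      hence "(1 / W) *\<^sub>R (W *\<^sub>R x) = (A1 x / W) *\<^sub>R u2 + (A2 x / W) *\<^sub>R u1 + ((W - A1 x - A2 x) / W) *\<^sub>R q"
        by (simp add: scaleR_add_right)
      hence "x = (A1 x / W) *\<^sub>R u2 + (A2 x / W) *\<^sub>R u1 + ((W - A1 x - A2 x) / W) *\<^sub>R q"
        using Wpos by simp
      moreover have "A1 x / W + A2 x / W + (W - A1 x - A2 x) / W = 1"
        using Wpos by (simp add: add_divide_distrib[symmetric])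
      moreover have "0 \<le> A1 x / W" "0 \<le> A2 x / W" "0 \<le> (W - A1 x - A2 x) / W"
        using x le Wpos by auto
      ultimately have "x \<in> convex hull {u2, u1, q}" unfolding convex_hull_3 by blast
      moreover have "convex hull {u2, u1, q} \<subseteq> Q"
        using u_Z Z_Q cQ by (intro hull_minimal convex_Q) (auto simp: q_def)
      ultimately show ?thesis by blast
    qed
    have "closed ({x. A1 x \<le> 0} \<union> {x. A2 x \<le> 0})"
      unfolding A1_def A2_def by (intro closed_Un closed_Collect_le continuous_intros)
    moreover have "T - Q \<subseteq> {x. A1 x \<le> 0} \<union> {x. A2 x \<le> 0}" using in_Q by force
    ultimately have "closure (T - Q) \<subseteq> {x. A1 x \<le> 0} \<union> {x. A2 x \<le> 0}" by (rule closure_minimal[rotated])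
    hence "A1 p \<le> 0 \<or> A2 p \<le> 0" using p by (auto simp: sail_eq)
    moreover have "A1 p = (1 - c) * D p u1" "A2 p = (1 - c) * D u2 p"
      by (simp_all add: A1_def A2_def q_def algebra_simps)
    ultimately show False using int c by (simp add: mult_le_0_iff)
  qed
  thus "p \<in> B" using pZ by (simp add: B_def)
qed

lemma rel_interior_T: "rel_interior T = {x. 0 < D u2 x \<and> 0 < D x u1 \<and> Y x < of_int l}"
proof -
  have nc: "\<not> collinear {0, u1, u2}"
  proof
    assume "collinear {0, u1, u2}"
    then consider "u1 = 0" | "u2 = 0" | c where "u2 = c *\<^sub>R u1" by (auto simp: collinear_lemma)
    thus False using D_u_pos by cases auto
  qed
  have eq: "(\<exists>x y z. 0 < x \<and> 0 < y \<and> 0 < z \<and> x + y + z = 1 \<and> x *\<^sub>R 0 + y *\<^sub>R u1 + z *\<^sub>R u2 = v)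
      \<longleftrightarrow> 0 < D u2 v \<and> 0 < D v u1 \<and> Y v < of_int l" for v
  proof
    assume "\<exists>x y z. 0 < x \<and> 0 < y \<and> 0 < z \<and> x + y + z = 1 \<and> x *\<^sub>R 0 + y *\<^sub>R u1 + z *\<^sub>R u2 = v"
    then obtain x y z where *: "0 < x" "0 < y" "0 < z" "x + y + z = 1" "v = y *\<^sub>R u1 + z *\<^sub>R u2" by auto
    have "Y v = (y + z) * of_int l" by (simp add: * algebra_simps)
    also have "\<dots> < 1 * of_int l" using * l_pos by (intro mult_strict_right_mono) auto
    finally show "0 < D u2 v \<and> 0 < D v u1 \<and> Y v < of_int l" using * D_u_pos by simp
  next
    assume *: "0 < D u2 v \<and> 0 < D v u1 \<and> Y v < of_int l"
    have "D u2 v + D v u1 < D u2 u1" unfolding D_u_sum D_u using * st by (simp add: mult.commute)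
    hence "D u2 v / D u2 u1 + D v u1 / D u2 u1 < 1"
      using D_u_pos by (simp add: add_divide_distrib[symmetric])
    thus "\<exists>x y z. 0 < x \<and> 0 < y \<and> 0 < z \<and> x + y + z = 1 \<and> x *\<^sub>R 0 + y *\<^sub>R u1 + z *\<^sub>R u2 = v"
      using * D_u_pos D_expand_div[of u2 u1 v]
      by (intro exI[of _ "1 - D u2 v / D u2 u1 - D v u1 / D u2 u1"] exI[of _ "D u2 v / D u2 u1"]
          exI[of _ "D v u1 / D u2 u1"]) (auto simp: add.commute)
  qed
  have int: "interior T = {x. 0 < D u2 x \<and> 0 < D x u1 \<and> Y x < of_int l}"
    unfolding nabla_def by (subst interior_convex_hull_3_minimal[OF nc], simp) (simp only: eq)
  have "(1/3) *\<^sub>R u1 + (1/3) *\<^sub>R u2 \<in> interior T"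
    unfolding int using D_u_pos l_pos by simp
  thus ?thesis using int rel_interior_nonempty_interior by blast
qed

lemma interior_lattice_sum:
  fixes f :: "real \<Rightarrow> real"
  shows "(\<Sum>n \<in> rel_interior T \<inter> N. f (Y n))
       = (\<Sum>j\<in>{1..<l}. f (of_int j) * real_of_int ((s * j) div l - (t * j) div l))"
proof -
  define E where "E j = {(t * j) div l + 1..(s * j) div l}" for j
  define g where "g = (\<lambda>(j, x). of_int x *\<^sub>R e1 + of_int j *\<^sub>R e2)"
  have mem: "x \<in> E j \<longleftrightarrow> t * j < x * l \<and> x * l < s * j" if j: "j \<in> {1..<l}" for x j
  proof -
    have "x * l \<noteq> s * j"
    proof
      assume "x * l = s * j"
      hence "l dvd s * j" by (metis dvd_triv_right)
      hence "l dvd j" using coprime_sl by (simp add: coprime_commute coprime_dvd_mult_right_iff)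
      thus False using j zdvd_not_zless by auto
    qed
    hence "(x \<le> (s * j) div l) = (x * l < s * j)"
      using int_div_less_iff[OF l_pos, of "s * j" x] by linarith
    moreover have "((t * j) div l + 1 \<le> x) = (t * j < x * l)"
      using int_div_less_iff[OF l_pos, of "t * j" x] by linarith
    ultimately show ?thesis unfolding E_def by auto
  qed
  have bij: "bij_betw g (SIGMA j:{1..<l}. E j) (rel_interior T \<inter> N)"
  proof (rule bij_betwI')
    fix a b
    show "(g a = g b) = (a = b)"
    proof
      assume "g a = g b"
      hence "X (g a) = X (g b)" "Y (g a) = Y (g b)" by simp_all
      thus "a = b" by (simp add: g_def split: prod.splits)
    qed simp
  next
    fix a assume "a \<in> (SIGMA j:{1..<l}. E j)"
    then obtain j x where a: "a = (j, x)" "j \<in> {1..<l}" "x \<in> E j" by blast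
    hence "real_of_int (t * j) < of_int (x * l)" "real_of_int (x * l) < of_int (s * j)"
      using mem by (simp_all only: of_int_less_iff)
    thus "g a \<in> rel_interior T \<inter> N" using a(2)
      by (simp add: rel_interior_T a(1) g_def D_XY mem_N mult.commute)
  next
    fix n assume n: "n \<in> rel_interior T \<inter> N"
    obtain x j where xj: "X n = of_int x" "Y n = of_int j" using n by (auto simp: mem_N elim!: Ints_cases)
    have *: "0 < D u2 n" "0 < D n u1" "Y n < of_int l" using n by (auto simp: rel_interior_T)
    have "0 < Y n" using *(1,2) eq_0_if_Y_le_0[of n] by (smt (verit) D_simps(7))
    hence j: "j \<in> {1..<l}" using * xj by simp
    have "real_of_int (t * j) < of_int (x * l)" "real_of_int (x * l) < of_int (s * j)"
      using * by (simp_all add: D_XY xj mult.commute)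
    hence "x \<in> E j" using mem[OF j] by (simp only: of_int_less_iff)
    moreover have "n = g (j, x)" using XY_expand[of n] by (simp add: g_def xj)
    ultimately show "\<exists>a\<in>(SIGMA j:{1..<l}. E j). n = g a" using j by blast
  qed
  have "(\<Sum>n \<in> rel_interior T \<inter> N. f (Y n)) = (\<Sum>a\<in>(SIGMA j:{1..<l}. E j). f (Y (g a)))"
    by (rule sum.reindex_bij_betw[OF bij, symmetric])
  also have "\<dots> = (\<Sum>j\<in>{1..<l}. \<Sum>x\<in>E j. f (of_int j))"
    by (subst sum.Sigma) (auto simp: E_def g_def split: prod.splits intro!: sum.cong)
  also have "\<dots> = (\<Sum>j\<in>{1..<l}. f (of_int j) * real_of_int ((s * j) div l - (t * j) div l))"
  proof (rule sum.cong)
    fix j assume j: "j \<in> {1..<l}"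
    have "(t * j) div l \<le> (s * j) div l" using st j l_pos by (intro zdiv_mono1 mult_right_mono) auto
    hence "real (card (E j)) = real_of_int ((s * j) div l - (t * j) div l)" unfolding E_def by simp
    thus "(\<Sum>x\<in>E j. f (of_int j)) = f (of_int j) * real_of_int ((s * j) div l - (t * j) div l)" by simp
  qed simp
  finally show ?thesis .
qed

definition rep :: "real^2 \<Rightarrow> real^2" where
  "rep v = (- 1 / cross2 e1 e2) *\<^sub>R vector [- v$2, v$1]"

lemma rep_inner [simp]: "rep v \<bullet> x = D v x"
  by (simp add: rep_def inner_vec_def UNIV_2 vector_2 D_def cross2_def diff_divide_distrib)

lemma rep_simps: "rep (a + b) = rep a + rep b" "rep (a - b) = rep a - rep b" "rep (c *\<^sub>R a) = c *\<^sub>R rep a"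
  by (simp_all add: rep_def vec_eq_iff forall_2 vector_2 algebra_simps add_divide_distrib diff_divide_distrib)

lemma cross2_rep: "cross2 (rep v) (rep w) = - D v w / cross2 e1 e2"
  by (simp add: rep_def D_def cross2_def vector_2 diff_divide_distrib)

lemma D_nonzero_cross2: "D a b \<noteq> 0 \<Longrightarrow> cross2 a b \<noteq> 0"
  by (auto simp: D_def)

lemma lattice_basis_N: "lattice_basis N e1 e2"
  unfolding lattice_basis_def using N_eq independent_if_cross2[OF basis] by blast

lemma covolume_N: "covolume N = \<bar>cross2 e1 e2\<bar>"
  using covolume_eq[OF lattice_basis_N] by (simp add: cross2_def)

lemma rep_in_dual: "v \<in> N \<Longrightarrow> rep v \<in> dual_lattice N"
  by (simp add: dual_lattice_def D_Ints)

lemma lattice_basis_dual: "lattice_basis (dual_lattice N) (rep e2) (rep e1)"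
proof -
  have "cross2 (rep e2) (rep e1) \<noteq> 0" using basis by (simp add: cross2_rep D_e)
  moreover have "dual_lattice N = {of_int x *\<^sub>R rep e2 + of_int y *\<^sub>R rep e1 | x y. True}"
  proof (intro equalityI subsetI)
    fix m assume m: "m \<in> dual_lattice N"
    have "e1 \<in> N" "e2 \<in> N" by (simp_all add: mem_N)
    hence "m \<bullet> e1 \<in> \<int>" "m \<bullet> e2 \<in> \<int>" using m by (auto simp: dual_lattice_def)
    then obtain a b where ab: "m \<bullet> e1 = of_int a" "m \<bullet> e2 = of_int b" by (elim Ints_cases)
    have "m = of_int a *\<^sub>R rep e2 + of_int (- b) *\<^sub>R rep e1"
      by (rule inner_eq_unique[OF basis]) (simp_all add: ab inner_simps D_e)
    thus "m \<in> {of_int x *\<^sub>R rep e2 + of_int y *\<^sub>R rep e1 | x y. True}" by blast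
  next
    fix m assume "m \<in> {of_int x *\<^sub>R rep e2 + of_int y *\<^sub>R rep e1 | x y. True}"
    then obtain x y where m: "m = of_int x *\<^sub>R rep e2 + of_int y *\<^sub>R rep e1" by blast
    show "m \<in> dual_lattice N" unfolding dual_lattice_def m
      by (auto simp: inner_simps D_Ints mem_N)
  qed
  ultimately show ?thesis unfolding lattice_basis_def using independent_if_cross2 by blast
qed

lemma covolume_dual: "covolume (dual_lattice N) = 1 / \<bar>cross2 e1 e2\<bar>"
proof -
  have "covolume (dual_lattice N) = \<bar>cross2 (rep e2) (rep e1)\<bar>"
    using covolume_eq[OF lattice_basis_dual] by (simp add: cross2_def)
  thus ?thesis by (simp add: cross2_rep D_e)
qed

lemma dual_triangle_volume:
  "normalized_volume (dual_lattice N) (convex hull {rep a, rep b, rep c}) = \<bar>D (b - a) (c - a)\<bar>"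
  unfolding normalized_volume_def cross2_triangle_area covolume_dual rep_simps[symmetric] cross2_rep
  using basis by (simp add: abs_divide)

lemma m_cone_eq: "m_cone u1 u2 = rep ((1 / of_int l) *\<^sub>R e1)"
  unfolding m_cone_def
proof (rule the_equality)
  show *: "rep ((1 / of_int l) *\<^sub>R e1) \<bullet> u1 = - 1 \<and> rep ((1 / of_int l) *\<^sub>R e1) \<bullet> u2 = - 1"
    using l_pos D_commute[of e1] by (simp add: Y_def[symmetric])
  fix m assume "m \<bullet> u1 = - 1 \<and> m \<bullet> u2 = - 1"
  thus "m = rep ((1 / of_int l) *\<^sub>R e1)" using * D_u_pos
    by (intro inner_eq_unique[OF D_nonzero_cross2[of u2 u1]]) auto
qed

lemma negligible_D:
  assumes "v \<noteq> 0"
  shows "negligible {x. D v x = c}"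
proof -
  have "rep v \<noteq> 0"
  proof
    assume "rep v = 0"
    hence "D v x = 0" for x by (metis inner_zero_left rep_inner)
    from this[of e1] this[of e2] have "v = 0"
      using XY_expand[of v] D_commute[of v e2] by (simp add: X_def Y_def)
    thus False using assms by simp
  qed
  hence "negligible {x. rep v \<bullet> x = c}" by (intro negligible_hyperplane) simp
  thus ?thesis by simp
qed

end

subsection \<open>Chains of sail points\<close>

locale lattice_triangle_chain = lattice_triangle +
  fixes k :: nat and p :: "nat \<Rightarrow> real^2"
  assumes sail_points: "sail_points N u1 u2 k p"
begin

lemma p_bij: "bij_betw p {0..k} B" and p_0: "p 0 = u2" and p_k: "p k = u1"
  using sail_points unfolding sail_points_def closure_sail_lattice by blast+

lemma p_B: "i \<le> k \<Longrightarrow> p i \<in> B"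
  using bij_betw_apply[OF p_bij] by simp

lemma p_T: "i \<le> k \<Longrightarrow> p i \<in> T" and p_N: "i \<le> k \<Longrightarrow> p i \<in> N" and p_Z: "i \<le> k \<Longrightarrow> p i \<in> Z"
  using p_B B_Z by (auto simp: Z_def)

lemma k_pos: "0 < k"
proof (rule ccontr)
  assume "\<not> 0 < k"
  hence "u1 = u2" using p_0 p_k by simp
  thus False using D_u_pos by simp
qed

lemma D_chain_nonneg:
  assumes "i \<le> j" "j \<le> k"
  shows "0 \<le> D (p i) (p j)"
proof -
  have "p j \<in> convex_cone hull {p i, u1}" using sail_points assms unfolding sail_points_def by blast
  then obtain a b where "0 \<le> a" "0 \<le> b" "p j = a *\<^sub>R p i + b *\<^sub>R u1" unfolding mem_convex_cone_hull_2 by blast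
  moreover have "0 \<le> D (p i) u1" using p_T[of i] assms by (simp add: mem_T)
  ultimately show ?thesis by simp
qed

lemma D_chain_pos:
  assumes "i < j" "j \<le> k"
  shows "0 < D (p i) (p j)"
proof (rule ccontr)
  assume "\<not> ?thesis"
  hence D0: "D (p i) (p j) = 0" using D_chain_nonneg[of i j] assms by simp
  have Y: "1 \<le> Y (p i)" "1 \<le> Y (p j)" using Z_Y_ge_1 p_Z assms by auto
  define c where "c = Y (p j) / Y (p i)"
  have j: "p j = c *\<^sub>R p i" using D0 Y by (intro XY_eqI) (auto simp: D_XY c_def field_simps)
  moreover have "c > 0" using Y by (simp add: c_def)
  ultimately have i: "p i = (1 / c) *\<^sub>R p j" by simp
  have "1 \<le> c" using B_multiple[OF p_B p_Z j] assms by simp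
  moreover have "1 \<le> 1 / c" using B_multiple[OF p_B p_Z i] assms by simp
  ultimately have "c = 1" by (simp add: field_simps)
  hence "p j = p i" using j by simp
  moreover have "inj_on p {0..k}" using p_bij by (simp add: bij_betw_def)
  ultimately show False using inj_onD[of p "{0..k}" j i] assms by simp
qed

lemma chain:
  assumes "i < k"
  shows chain_unimodular: "D (p i) (p (Suc i)) = 1"
    and chain_ge: "\<And>z. z \<in> Z \<Longrightarrow> 1 \<le> D (p i) z + D z (p (Suc i))"
proof -
  have none: "\<not> (0 < D (p i) b \<and> 0 < D b (p (Suc i)))" if "b \<in> B" for b
  proof
    assume *: "0 < D (p i) b \<and> 0 < D b (p (Suc i))"
    have "b \<in> p ` {0..k}" using p_bij \<open>b \<in> B\<close> by (simp add: bij_betw_def)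
    then obtain j where j: "j \<le> k" "b = p j" by auto
    have "i < j" using * j D_chain_nonneg[of j i] assms D_commute[of "p i" "p j"] by (cases "i < j") auto
    moreover have "j < Suc i" using * j D_chain_nonneg[of "Suc i" j] assms D_commute[of "p j" "p (Suc i)"]
      by (cases "j < Suc i") auto
    ultimately show False by simp
  qed
  have *: "p i \<in> B" "p (Suc i) \<in> B" "0 < D (p i) (p (Suc i))" using p_B D_chain_pos assms by auto
  show u: "D (p i) (p (Suc i)) = 1" by (rule consecutive_unimodular[OF * none])
  show "1 \<le> D (p i) z + D z (p (Suc i))" if "z \<in> Z" for z
    using consecutive_ge[OF * none that] u by simp
qed

definition a :: "nat \<Rightarrow> real" where "a i = D (p (i - 1)) (p (i + 1))"

lemma chain_relation:
  assumes "1 \<le> i" "i < k"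
  shows "p (i - 1) + p (i + 1) = a i *\<^sub>R p i" and "2 \<le> a i"
proof -
  have u: "D (p (i - 1)) (p i) = 1" "D (p i) (p (i + 1)) = 1"
    using chain_unimodular[of "i - 1"] chain_unimodular[of i] assms by simp_all
  show "p (i - 1) + p (i + 1) = a i *\<^sub>R p i"
    using D_expand[of "p (i - 1)" "p (i + 1)" "p i"] u by (simp add: a_def)
  have "1 \<le> D (p (i - 1)) (p (i + 1)) + D (p (i + 1)) (p i)"
    using chain_ge[of "i - 1" "p (i + 1)"] p_Z assms by simp
  thus "2 \<le> a i" using u(2) D_commute[of "p (i + 1)" "p i"] by (simp add: a_def)
qed

lemma m_sub_eq:
  assumes "1 \<le> i" "i \<le> k"
  shows "m_sub N p i = rep (p i - p (i - 1))"
  unfolding m_sub_def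
proof (rule the_equality)
  have u: "D (p (i - 1)) (p i) = 1" using chain_unimodular[of "i - 1"] assms by simp
  show *: "rep (p i - p (i - 1)) \<in> dual_lattice N \<and> rep (p i - p (i - 1)) \<bullet> p (i - 1) = - 1
      \<and> rep (p i - p (i - 1)) \<bullet> p i = - 1"
    using u D_commute[of "p i" "p (i - 1)"] p_N assms by (simp add: rep_in_dual mem_N)
  fix m assume "m \<in> dual_lattice N \<and> m \<bullet> p (i - 1) = - 1 \<and> m \<bullet> p i = - 1"
  thus "m = rep (p i - p (i - 1))" using * u
    by (intro inner_eq_unique[OF D_nonzero_cross2[of "p (i - 1)" "p i"]]) auto
qed

lemma dual_volume:
  assumes "1 \<le> i" "i < k"
  shows "normalized_volume (dual_lattice N) (convex hull {m_cone u1 u2, m_sub N p i, m_sub N p (i + 1)})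
       = (a i - 2) * (1 - Y (p i) / of_int l)"
proof -
  define E where "E = (1 / real_of_int l) *\<^sub>R e1"
  have u: "D (p (i - 1)) (p i) = 1" "D (p i) (p (i + 1)) = 1"
    using chain_unimodular[of "i - 1"] chain_unimodular[of i] assms by simp_all
  have E: "D x E = Y x / of_int l" "D E x = - Y x / of_int l" for x
    using D_commute[of e1 x] by (simp_all add: E_def Y_def)
  have r: "Y (p (i - 1)) + Y (p (i + 1)) = a i * Y (p i)"
    using chain_relation(1)[OF assms] by (metis XY_simps(5,7))
  have "D (p i - p (i - 1) - E) (p (i + 1) - p i - E)
      = 2 - a i + (Y (p (i - 1)) + Y (p (i + 1)) - 2 * Y (p i)) / of_int l"
    using u by (simp add: E a_def add_divide_distrib diff_divide_distrib) (simp add: E_def)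
  also have "\<dots> = - ((a i - 2) * (1 - Y (p i) / of_int l))"
    unfolding r by (simp add: algebra_simps diff_divide_distrib)
  finally have e: "D (p i - p (i - 1) - E) (p (i + 1) - p i - E) = - ((a i - 2) * (1 - Y (p i) / of_int l))" .
  have "Y (p i) / of_int l \<le> 1" using p_T[of i] assms l_pos by (simp add: mem_T)
  hence "0 \<le> (a i - 2) * (1 - Y (p i) / of_int l)" using chain_relation(2)[OF assms] by simp
  thus ?thesis using e assms unfolding m_cone_eq E_def[symmetric]
    by (simp add: m_sub_eq dual_triangle_volume del: D_simps)
qed

lemma Q_volume: "normalized_volume N (T - sail N u1 u2) = D u2 u1 - real k"
proof -
  define tri where "tri i = convex hull {0, p i, p (Suc i)}" for i
  have mem_tri: "x \<in> tri i \<longleftrightarrow> 0 \<le> D (p i) x \<and> 0 \<le> D x (p (Suc i)) \<and> D (p i) x + D x (p (Suc i)) \<le> 1"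
    if "i < k" for x i
    unfolding tri_def using mem_triangle[of "p i" "p (Suc i)" x] chain_unimodular[OF that] by simp
  define f where "f i = (if i = k then Q else tri i)" for i
  have tri_T: "tri i \<subseteq> T" if "i < k" for i
    unfolding tri_def using that p_T by (intro hull_minimal convex_T) (auto simp: nabla_def hull_inc)
  have cover: "x \<in> Q \<or> (\<exists>i<k. x \<in> tri i)" if x: "x \<in> T" for x
  proof -
    have "\<exists>i<k. 0 \<le> D (p i) x \<and> 0 \<le> D x (p (Suc i))"
    proof -
      define P where "P i \<longleftrightarrow> 0 < i \<and> 0 \<le> D x (p i)" for i
      have "P k" using x k_pos by (simp add: P_def p_k mem_T)
      define j where "j = (LEAST i. P i)"
      have j: "P j" unfolding j_def using \<open>P k\<close> by (rule LeastI)
      have jk: "j \<le> k" unfolding j_def using \<open>P k\<close> by (rule Least_le)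
      have "0 \<le> D (p (j - 1)) x"
      proof (cases "j = 1")
        case True
        thus ?thesis using x by (simp add: p_0 mem_T)
      next
        case False
        hence "\<not> P (j - 1)" using j not_less_Least[of "j - 1" P] unfolding j_def[symmetric] by (simp add: P_def)
        thus ?thesis using False j D_commute[of x "p (j - 1)"] by (simp add: P_def)
      qed
      thus ?thesis using j jk by (intro exI[of _ "j - 1"]) (auto simp: P_def)
    qed
    then obtain i where i: "i < k" "0 \<le> D (p i) x" "0 \<le> D x (p (Suc i))" by blast
    define h where "h = D (p i) x + D x (p (Suc i))"
    show ?thesis
    proof (cases "h \<le> 1")
      case True
      thus ?thesis using i mem_tri unfolding h_def by blast
    next
      case False
      define y where "y = (1 / h) *\<^sub>R x"
      have "y \<in> convex hull {p i, p (Suc i)}" unfolding convex_hull_2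
      proof -
        have "x = D x (p (Suc i)) *\<^sub>R p i + D (p i) x *\<^sub>R p (Suc i)"
          using D_expand[of "p i" "p (Suc i)" x] chain_unimodular[OF i(1)] by simp
        hence "(1 / h) *\<^sub>R x = (1 / h) *\<^sub>R (D x (p (Suc i)) *\<^sub>R p i + D (p i) x *\<^sub>R p (Suc i))" by simp
        hence "y = (D x (p (Suc i)) / h) *\<^sub>R p i + (D (p i) x / h) *\<^sub>R p (Suc i)"
          unfolding y_def by (simp add: scaleR_add_right)
        moreover have "D x (p (Suc i)) / h + D (p i) x / h = 1"
          using False by (simp add: add_divide_distrib[symmetric] h_def)
        moreover have "0 \<le> D x (p (Suc i)) / h" "0 \<le> D (p i) x / h" using i False by simp_all
        ultimately show "y \<in> {u *\<^sub>R p i + v *\<^sub>R p (Suc i) | u v. 0 \<le> u \<and> 0 \<le> v \<and> u + v = 1}" by blast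
      qed
      moreover have "convex hull {p i, p (Suc i)} \<subseteq> Q"
        using p_B B_Q i(1) by (intro hull_minimal convex_Q) auto
      ultimately have "y \<in> Q" by blast
      moreover have "x = h *\<^sub>R y" using False by (simp add: y_def)
      ultimately show ?thesis using Q_upward[of y h] False x by simp
    qed
  qed
  have T_eq: "T = (\<Union>i\<in>{..k}. f i)"
  proof (intro equalityI subsetI)
    fix x assume "x \<in> T"
    then consider "x \<in> f k" | i where "i < k" "x \<in> f i" using cover[of x] by (auto simp: f_def)
    thus "x \<in> (\<Union>i\<in>{..k}. f i)" by cases auto
  next
    fix x assume "x \<in> (\<Union>i\<in>{..k}. f i)"
    then obtain i where "i \<le> k" "x \<in> f i" by auto
    thus "x \<in> T" using tri_T[of i] Q_T by (cases "i = k") (auto simp: f_def)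
  qed
  have meas: "f i \<in> lmeasurable" for i
    unfolding f_def tri_def using compact_Q
    by (auto intro!: lmeasurable_compact finite_imp_compact_convex_hull)
  have Qtri: "negligible (Q \<inter> tri i)" if i: "i < k" for i
  proof -
    have "Q \<inter> tri i \<subseteq> {x. D (p i - p (Suc i)) x = 1}"
    proof
      fix x assume x: "x \<in> Q \<inter> tri i"
      have lin: "linear (\<lambda>z. D (p i) z + D z (p (Suc i)))" by (intro linearI) (simp_all add: algebra_simps)
      have "1 \<le> D (p i) x + D x (p (Suc i))" using x by (intro Q_ge[OF lin chain_ge[OF i]]) auto
      thus "x \<in> {x. D (p i - p (Suc i)) x = 1}"
        using x mem_tri[OF i] D_commute[of "p (Suc i)" x] by force
    qed
    moreover have "p i - p (Suc i) \<noteq> 0" using chain_unimodular[OF i] by auto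
    ultimately show ?thesis using negligible_D negligible_subset by blast
  qed
  have tritri: "negligible (tri i \<inter> tri j)" if ij: "i < j" "j < k" for i j
  proof -
    have "tri i \<inter> tri j \<subseteq> {x. D (p j) x = 0}"
    proof
      fix x assume x: "x \<in> tri i \<inter> tri j"
      hence "x \<in> convex hull {0, p i, p (Suc i)}" by (simp add: tri_def)
      then obtain b c where "0 \<le> b" "0 \<le> c" "x = b *\<^sub>R p i + c *\<^sub>R p (Suc i)"
        unfolding mem_convex_hull_0_2 by blast
      hence "0 \<le> D x (p j)" using D_chain_nonneg[of i j] D_chain_nonneg[of "Suc i" j] ij by simp
      moreover have "0 \<le> D (p j) x" using x mem_tri[OF ij(2)] by simp
      ultimately show "x \<in> {x. D (p j) x = 0}" using D_commute[of x "p j"] by simp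
    qed
    moreover have "p j \<noteq> 0" using p_Z[of j] ij by (auto simp: Z_def)
    ultimately show ?thesis using negligible_D negligible_subset by blast
  qed
  have pw: "pairwise (\<lambda>i j. negligible (f i \<inter> f j)) {..k}"
  proof (rule pairwiseI)
    fix i j assume "i \<in> {..k}" "j \<in> {..k}" "i \<noteq> j"
    thus "negligible (f i \<inter> f j)"
      using Qtri[of i] Qtri[of j] tritri[of i j] tritri[of j i] unfolding f_def
      by (cases i j rule: linorder_cases) (auto simp: Int_commute)
  qed
  have tri_area: "measure lebesgue (tri i) = \<bar>cross2 e1 e2\<bar> / 2" if "i < k" for i
  proof -
    have "cross2 (p i) (p (Suc i)) = - cross2 e1 e2"
      using chain_unimodular[OF that] basis by (simp add: D_def field_simps)
    thus ?thesis unfolding tri_def cross2_triangle_area by simp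
  qed
  have T_area: "measure lebesgue T = D u2 u1 * \<bar>cross2 e1 e2\<bar> / 2"
  proof -
    have "cross2 u1 u2 = D u2 u1 * cross2 e1 e2" using basis cross2_commute[of u1 u2] by (simp add: D_def)
    thus ?thesis unfolding nabla_def cross2_triangle_area using D_u_pos by (simp add: abs_mult)
  qed
  have "measure lebesgue T = (\<Sum>i\<in>{..k}. measure lebesgue (f i))"
    unfolding T_eq by (rule measure_negligible_finite_Union_image[OF _ meas pw]) auto
  also have "{..k} = insert k {..<k}" by auto
  also have "(\<Sum>i\<in>insert k {..<k}. measure lebesgue (f i)) = measure lebesgue Q + (\<Sum>i<k. measure lebesgue (tri i))"
    by (simp add: f_def)
  also have "(\<Sum>i<k. measure lebesgue (tri i)) = real k * (\<bar>cross2 e1 e2\<bar> / 2)"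
  proof -
    have "(\<Sum>i<k. measure lebesgue (tri i)) = (\<Sum>i<k. \<bar>cross2 e1 e2\<bar> / 2)"
      by (intro sum.cong refl tri_area) simp
    thus ?thesis by simp
  qed
  finally have "measure lebesgue Q = (D u2 u1 - real k) * \<bar>cross2 e1 e2\<bar> / 2"
    unfolding T_area by (simp add: algebra_simps)
  moreover have "T - sail N u1 u2 = Q" using Q_T by (auto simp: sail_eq)
  ultimately show ?thesis unfolding normalized_volume_def covolume_N using basis by (simp add: field_simps)
qed

theorem triangle_formula:
  "12 * (\<Sum>n \<in> rel_interior T \<inter> N. (1 - Y n / of_int l)\<^sup>2) =
    normalized_volume N (T - sail N u1 u2) +
    (\<Sum>i\<in>{1..<k}. normalized_volume (dual_lattice N)
       (convex hull {m_cone u1 u2, m_sub N p i, m_sub N p (i + 1)}))"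
proof -
  have "\<exists>b. \<forall>i\<le>k. X (p i) = of_int (fst (b i)) \<and> Y (p i) = of_int (snd (b i))"
    by (rule exI[of _ "\<lambda>i. (\<lfloor>X (p i)\<rfloor>, \<lfloor>Y (p i)\<rfloor>)"]) (use p_N in \<open>auto simp: mem_N\<close>)
  then obtain b where b: "\<And>i. i \<le> k \<Longrightarrow> X (p i) = of_int (fst (b i))" "\<And>i. i \<le> k \<Longrightarrow> Y (p i) = of_int (snd (b i))"
    by blast
  define x y where "x i = fst (b i)" and "y i = snd (b i)" for i
  have X: "X (p i) = of_int (x i)" and Y: "Y (p i) = of_int (y i)" if "i \<le> k" for i
    using b[OF that] by (simp_all add: x_def y_def)
  define c where "c i = \<lfloor>a i\<rfloor>" for i
  have c: "a i = of_int (c i)" if "1 \<le> i" "i < k" for i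
    unfolding c_def a_def using D_Ints[of "p (i - 1)" "p (i + 1)"] p_N that by simp
  have ends: "y 0 = l" "y k = l" "x 0 = t" "x k = s"
    using X[of 0] X[of k] Y[of 0] Y[of k] by (simp_all add: p_0 p_k)
  have pos: "0 < y i" if "i \<le> k" for i
    using Z_Y_ge_1[OF p_Z[OF that]] Y[OF that] by simp
  have unim: "x (Suc i) * y i - x i * y (Suc i) = 1" if "i < k" for i
  proof -
    have "real_of_int (x (Suc i) * y i - x i * y (Suc i)) = 1"
      using chain_unimodular[OF that] X[of i] X[of "Suc i"] Y[of i] Y[of "Suc i"] that by (simp add: D_XY)
    thus ?thesis by linarith
  qed
  have rec: "y (i - 1) + y (i + 1) = c i * y i" if "1 \<le> i" "i < k" for i
  proof -
    have "Y (p (i - 1)) + Y (p (i + 1)) = a i * Y (p i)"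
      using chain_relation(1)[OF that] by (metis XY_simps(5,7))
    hence "real_of_int (y (i - 1) + y (i + 1)) = of_int (c i * y i)"
      using Y[of "i - 1"] Y[of i] Y[of "i + 1"] c[OF that] that by simp
    thus ?thesis by (simp only: of_int_eq_iff)
  qed
  have "12 * (\<Sum>n \<in> rel_interior T \<inter> N. (1 - Y n / of_int l)\<^sup>2)
      = of_int (s - t) * of_int l - of_nat k + (\<Sum>i\<in>{1..<k}. of_int (c i - 2) * (1 - of_int (y i) / of_int l))"
    using weighted_sum_unimodular_chain[of k y l x c, OF k_pos ends(1,2) pos unim rec]
    unfolding interior_lattice_sum[of "\<lambda>v. (1 - v / of_int l)\<^sup>2"] ends by simp
  also have "(\<Sum>i\<in>{1..<k}. of_int (c i - 2) * (1 - of_int (y i) / of_int l))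
      = (\<Sum>i\<in>{1..<k}. normalized_volume (dual_lattice N)
       (convex hull {m_cone u1 u2, m_sub N p i, m_sub N p (i + 1)}))"
    by (intro sum.cong) (use dual_volume c Y in auto)
  finally show ?thesis unfolding Q_volume D_u by (simp add: mult.commute)
qed

end

subsection \<open>Cones over edges of LDP polygons\<close>

lemma lattice_basis_cross2: "lattice_basis N b1 b2 \<Longrightarrow> cross2 b1 b2 \<noteq> 0"
  using independent_2_det unfolding lattice_basis_def cross2_def by blast

lemma primitive_coprime:
  assumes N: "N = {of_int x *\<^sub>R b1 + of_int y *\<^sub>R b2 | x y. True}"
    and "primitive N (of_int a *\<^sub>R b1 + of_int b *\<^sub>R b2)"
  shows "coprime a b"
proof -
  define g where "g = gcd a b"
  obtain a' b' where ab: "a = g * a'" "b = g * b'" unfolding g_def by (meson dvdE gcd_dvd1 gcd_dvd2)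
  have "of_int a *\<^sub>R b1 + of_int b *\<^sub>R b2 = of_int g *\<^sub>R (of_int a' *\<^sub>R b1 + of_int b' *\<^sub>R b2)"
    by (simp add: ab scaleR_add_right)
  moreover have "of_int a' *\<^sub>R b1 + of_int b' *\<^sub>R b2 \<in> N" using N by blast
  ultimately have "\<bar>g\<bar> = 1" using assms(2) unfolding primitive_def by blast
  thus ?thesis by (simp add: g_def coprime_iff_gcd_eq_1)
qed

lemma primitive_pos_multiple:
  assumes "is_lattice N" "primitive N v" "primitive N (r *\<^sub>R v)" "0 < r"
  shows "r = 1"
proof -
  obtain b1 b2 where b: "lattice_basis N b1 b2" using assms(1) unfolding is_lattice_def by blast
  hence N: "N = {of_int x *\<^sub>R b1 + of_int y *\<^sub>R b2 | x y. True}" by (simp add: lattice_basis_def)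
  have d: "cross2 b1 b2 \<noteq> 0" by (rule lattice_basis_cross2[OF b])
  obtain a c where v: "v = of_int a *\<^sub>R b1 + of_int c *\<^sub>R b2"
    using assms(2) unfolding primitive_def N by blast
  obtain x y where w: "r *\<^sub>R v = of_int x *\<^sub>R b1 + of_int y *\<^sub>R b2"
    using assms(3) unfolding primitive_def N by blast
  have "cross2 (r *\<^sub>R v) b2 = of_int x * cross2 b1 b2" "cross2 b1 (r *\<^sub>R v) = of_int y * cross2 b1 b2"
    unfolding w by simp_all
  hence xy: "r * of_int a = of_int x" "r * of_int c = of_int y" using d by (simp_all add: v)
  have "coprime a c" using assms(2) unfolding v by (rule primitive_coprime[OF N])
  then obtain m n where "m * a + n * c = 1" by (metis bezout_int coprime_iff_gcd_eq_1)
  hence "real_of_int m * of_int a + of_int n * of_int c = 1" by (metis of_int_1 of_int_add of_int_mult)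
  hence "r = of_int m * (r * of_int a) + of_int n * (r * of_int c)"
    by (metis (no_types, opaque_lifting) distrib_left mult.left_commute mult.right_neutral)
  hence r: "r = of_int (m * x + n * y)" unfolding xy by simp
  moreover have "v \<in> N" using assms(2) by (simp add: primitive_def)
  ultimately have "\<bar>m * x + n * y\<bar> = 1" using assms(3) unfolding primitive_def by blast
  thus ?thesis using assms(4) unfolding r by simp
qed

lemma mem_line_iff_cross2:
  assumes "v \<noteq> 0"
  shows "x \<in> range (\<lambda>r. r *\<^sub>R v) \<longleftrightarrow> cross2 v x = 0"
proof
  assume 0: "cross2 v x = 0"
  show "x \<in> range (\<lambda>r. r *\<^sub>R v)"
  proof (cases "v $ 1 = 0")
    case True
    hence "v $ 2 \<noteq> 0" using assms by (auto simp: vec_eq_iff forall_2)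
    hence "x = (x $ 2 / v $ 2) *\<^sub>R v" using 0 True by (simp add: vec_eq_iff forall_2 cross2_def)
    thus ?thesis by (rule range_eqI)
  next
    case False
    hence "x = (x $ 1 / v $ 1) *\<^sub>R v" using 0 by (simp add: vec_eq_iff forall_2 cross2_def field_simps)
    thus ?thesis by (rule range_eqI)
  qed
qed auto

lemma adapted_basis:
  assumes "is_lattice N" "primitive N u1" "primitive N u2" "cross2 u1 u2 \<noteq> 0"
  obtains e1 e2 s t l where "lattice_triangle N e1 e2 u1 u2 s t l"
proof -
  obtain b1 b2 where b: "lattice_basis N b1 b2" using assms(1) unfolding is_lattice_def by blast
  hence N: "N = {of_int x *\<^sub>R b1 + of_int y *\<^sub>R b2 | x y. True}" by (simp add: lattice_basis_def)
  obtain a1 c1 where u1: "u1 = of_int a1 *\<^sub>R b1 + of_int c1 *\<^sub>R b2"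
    using assms(2) unfolding primitive_def N by blast
  obtain a2 c2 where u2: "u2 = of_int a2 *\<^sub>R b1 + of_int c2 *\<^sub>R b2"
    using assms(3) unfolding primitive_def N by blast
  define d where "d = gcd (a1 - a2) (c1 - c2)"
  have "u1 \<noteq> u2" using assms(4) by auto
  hence "a1 - a2 \<noteq> 0 \<or> c1 - c2 \<noteq> 0" using u1 u2 by auto
  hence d: "0 < d" unfolding d_def by (simp add: gcd_pos_int)
  obtain a c where ac: "a1 - a2 = a * d" "c1 - c2 = c * d" "coprime a c"
    using gcd_coprime_exists[of "a1 - a2" "c1 - c2"] d unfolding d_def by auto
  obtain m n where mn: "m * a + n * c = 1" using ac(3) by (metis bezout_int coprime_iff_gcd_eq_1)
  have mn': "real_of_int m * of_int a + of_int n * of_int c = 1" using mn by (metis of_int_1 of_int_add of_int_mult)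
  define e f where "e = of_int a *\<^sub>R b1 + of_int c *\<^sub>R b2" and "f = of_int (- n) *\<^sub>R b1 + of_int m *\<^sub>R b2"
  have b1: "b1 = of_int m *\<^sub>R e + of_int (- c) *\<^sub>R f"
  proof -
    have "of_int m *\<^sub>R e + of_int (- c) *\<^sub>R f = (real_of_int m * of_int a + of_int n * of_int c) *\<^sub>R b1"
      by (simp add: e_def f_def algebra_simps)
    thus ?thesis by (simp add: mn')
  qed
  have b2: "b2 = of_int n *\<^sub>R e + of_int a *\<^sub>R f"
  proof -
    have "of_int n *\<^sub>R e + of_int a *\<^sub>R f = (real_of_int m * of_int a + of_int n * of_int c) *\<^sub>R b2"
      by (simp add: e_def f_def algebra_simps)
    thus ?thesis by (simp add: mn')
  qed
  have change: "of_int x *\<^sub>R b1 + of_int y *\<^sub>R b2 = of_int (x * m + y * n) *\<^sub>R e + of_int (y * a - x * c) *\<^sub>R f" for x y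
    by (subst b1, subst b2) (simp add: algebra_simps)
  have change': "of_int x *\<^sub>R e + of_int y *\<^sub>R f = of_int (x * a - y * n) *\<^sub>R b1 + of_int (x * c + y * m) *\<^sub>R b2" for x y
    by (simp add: e_def f_def algebra_simps)
  have Nf: "N = {of_int x *\<^sub>R e + of_int y *\<^sub>R f | x y. True}"
    unfolding N using change change' by blast
  define t l where "t = a2 * m + c2 * n" and "l = c2 * a - a2 * c"
  have u2f: "u2 = of_int t *\<^sub>R e + of_int l *\<^sub>R f" unfolding u2 change t_def l_def ..
  have "u1 - u2 = of_int (a1 - a2) *\<^sub>R b1 + of_int (c1 - c2) *\<^sub>R b2"
    by (simp add: u1 u2 algebra_simps)
  also have "\<dots> = of_int d *\<^sub>R e" unfolding ac by (simp add: e_def algebra_simps)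
  finally have u1f: "u1 = of_int (t + d) *\<^sub>R e + of_int l *\<^sub>R f" using u2f by (simp add: algebra_simps)
  have "cross2 u1 u2 = of_int d * of_int l * cross2 e f"
    unfolding u1f u2f using cross2_commute[of f e] by (simp add: algebra_simps)
  hence nz: "l \<noteq> 0" "cross2 e f \<noteq> 0" using assms(4) by auto
  have *: "lattice_triangle N e g u1 u2 (t + d) t h"
    if "N = {of_int x *\<^sub>R e + of_int y *\<^sub>R g | x y. True}" "cross2 e g \<noteq> 0" "0 < h"
      "u1 = of_int (t + d) *\<^sub>R e + of_int h *\<^sub>R g" "u2 = of_int t *\<^sub>R e + of_int h *\<^sub>R g" for g h
    using that d assms(2,3) primitive_coprime[OF that(1), of "t + d" h] primitive_coprime[OF that(1), of t h]
    by unfold_locales auto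
  show ?thesis
  proof (cases "0 < l")
    case True
    show ?thesis by (rule that[OF *[OF Nf nz(2) True u1f u2f]])
  next
    case False
    have "of_int x *\<^sub>R e + of_int y *\<^sub>R f = of_int x *\<^sub>R e + of_int (- y) *\<^sub>R (- f)"
      "of_int x *\<^sub>R e + of_int y *\<^sub>R (- f) = of_int x *\<^sub>R e + of_int (- y) *\<^sub>R f" for x y by simp_all
    hence "N = {of_int x *\<^sub>R e + of_int y *\<^sub>R (- f) | x y. True}" unfolding Nf by blast
    hence "lattice_triangle N e (- f) u1 u2 (t + d) t (- l)"
      by (rule *) (use nz False u1f u2f in auto)
    thus ?thesis by (rule that)
  qed
qed

lemma edge_cone:
  assumes lat: "is_lattice N" and LDP: "LDP_polygon N \<Delta>" and \<sigma>: "\<sigma> \<in> spanning_fan2 \<Delta>"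
    and gen: "primitive_generators N \<sigma> u1 u2"
  shows edge_cone_cross2: "cross2 u1 u2 \<noteq> 0"
    and edge_cone_kappa: "\<And>a b. 0 \<le> a \<Longrightarrow> 0 \<le> b \<Longrightarrow> kappa \<Delta> (a *\<^sub>R u1 + b *\<^sub>R u2) = - (a + b)"
proof -
  have prim: "primitive N u1" "primitive N u2" and cone: "\<sigma> = convex_cone hull {u1, u2}"
    using gen by (auto simp: primitive_generators_def)
  have nz: "u1 \<noteq> 0" "u2 \<noteq> 0" using prim by (auto simp: primitive_def)
  have mem: "x \<in> \<sigma> \<longleftrightarrow> (\<exists>a b. 0 \<le> a \<and> 0 \<le> b \<and> x = a *\<^sub>R u1 + b *\<^sub>R u2)" for x
    unfolding cone by (rule mem_convex_cone_hull_2)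
  show cross: "cross2 u1 u2 \<noteq> 0"
  proof
    assume 0: "cross2 u1 u2 = 0"
    hence "u2 \<in> span {u1}" using mem_line_iff_cross2[OF nz(1)] by (simp add: span_singleton)
    hence "\<sigma> \<subseteq> span {u1}" by (auto simp: mem span_add span_scale span_base)
    hence "aff_dim \<sigma> \<le> aff_dim (span {u1})" by (rule aff_dim_subset)
    also have "\<dots> = int (dim (span {u1}))" by (simp add: aff_dim_subspace)
    also have "\<dots> \<le> 1" using dim_le_card'[of "{u1}"] by (simp del: dim_singleton)
    finally show False using \<sigma> by (simp add: spanning_fan2_def)
  qed
  obtain \<theta> where \<theta>: "\<theta> face_of \<Delta>" "\<theta> \<noteq> \<Delta>" "\<sigma> = insert 0 (conic hull \<theta>)"
    using \<sigma> unfolding spanning_fan2_def spanning_fan_def by blast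
  have poly: "polytope \<Delta>" and int: "0 \<in> interior \<Delta>"
    and vert: "\<And>v. v extreme_point_of \<Delta> \<Longrightarrow> primitive N v"
    using LDP by (auto simp: LDP_polygon_def)
  have "\<theta> exposed_face_of \<Delta>"
    using exposed_face_of_polyhedron[OF polytope_imp_polyhedron[OF poly]] \<theta>(1) by blast
  then obtain g c where g: "\<Delta> \<subseteq> {x. g \<bullet> x \<le> c}" "\<theta> = \<Delta> \<inter> {x. g \<bullet> x = c}"
    unfolding exposed_face_of_def by blast
  have 0: "0 \<in> \<Delta>" using int interior_subset by blast
  have c: "0 < c"
  proof (rule ccontr)
    assume "\<not> 0 < c"
    hence c0: "c = 0" using g(1) 0 by auto
    have "g = 0"
    proof (rule ccontr)
      assume "g \<noteq> 0"
      obtain e where e: "0 < e" "ball 0 e \<subseteq> \<Delta>" using int by (auto simp: mem_interior)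
      have "(e / (2 * norm g)) *\<^sub>R g \<in> ball 0 e" using e \<open>g \<noteq> 0\<close> by simp
      hence "g \<bullet> ((e / (2 * norm g)) *\<^sub>R g) \<le> c" using e(2) g(1) by blast
      hence "(e / (2 * norm g)) * (g \<bullet> g) \<le> 0" unfolding c0 by (simp only: inner_scaleR_right)
      moreover have "0 < (e / (2 * norm g)) * (g \<bullet> g)" using e(1) \<open>g \<noteq> 0\<close> by simp
      ultimately show False by linarith
    qed
    thus False using g c0 \<theta>(2) by auto
  qed
  define h where "h = (1 / c) *\<^sub>R g"
  have h: "h \<bullet> x \<le> 1" if "x \<in> \<Delta>" for x using that g(1) c by (auto simp: h_def field_simps)
  have \<theta>_mem: "x \<in> \<theta> \<longleftrightarrow> x \<in> \<Delta> \<and> h \<bullet> x = 1" for x using g(2) c by (auto simp: h_def field_simps)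
  have \<theta>\<sigma>: "\<theta> \<subseteq> \<sigma>" using hull_subset[of \<theta> conic] \<theta>(3) by blast
  have ray: "0 < h \<bullet> u" "(1 / (h \<bullet> u)) *\<^sub>R u \<in> \<theta>" if u: "u \<in> \<sigma>" "u \<noteq> 0" for u
  proof -
    have "u \<in> conic hull \<theta>" using u \<theta>(3) by blast
    then obtain r x where rx: "0 \<le> r" "x \<in> \<theta>" "u = r *\<^sub>R x" by (auto simp: conic_hull_explicit)
    moreover have "r \<noteq> 0" using rx u(2) by auto
    moreover have "h \<bullet> x = 1" using rx(2) \<theta>_mem by blast
    ultimately show "0 < h \<bullet> u" "(1 / (h \<bullet> u)) *\<^sub>R u \<in> \<theta>" by simp_all
  qed
  have unit: "h \<bullet> u = 1" if u: "u \<in> \<sigma>" "primitive N u"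
    and edge: "\<And>y z r. \<lbrakk>y \<in> \<sigma>; z \<in> \<sigma>; 0 < r; r < 1; (1 - r) *\<^sub>R y + r *\<^sub>R z \<in> range (\<lambda>b. b *\<^sub>R u)\<rbrakk>
        \<Longrightarrow> y \<in> range (\<lambda>b. b *\<^sub>R u) \<and> z \<in> range (\<lambda>b. b *\<^sub>R u)" for u
  proof -
    have u0: "u \<noteq> 0" using u(2) by (auto simp: primitive_def)
    define x where "x = (1 / (h \<bullet> u)) *\<^sub>R u"
    have x: "x \<in> \<theta>" unfolding x_def by (rule ray(2)[OF u(1) u0])
    have pos: "0 < h \<bullet> u" by (rule ray(1)[OF u(1) u0])
    have "x extreme_point_of \<Delta>" unfolding extreme_point_of_def
    proof (intro conjI ballI notI)
      show "x \<in> \<Delta>" using x \<theta>_mem by blast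
      fix y z assume yz: "y \<in> \<Delta>" "z \<in> \<Delta>" "x \<in> open_segment y z"
      have yz\<theta>: "y \<in> \<theta>" "z \<in> \<theta>" using \<theta>(1) x yz unfolding face_of_def by blast+
      obtain r where r: "0 < r" "r < 1" "x = (1 - r) *\<^sub>R y + r *\<^sub>R z" and ne: "y \<noteq> z"
        using yz(3) by (auto simp: in_segment)
      have "x \<in> range (\<lambda>b. b *\<^sub>R u)" unfolding x_def by (rule rangeI)
      hence "y \<in> range (\<lambda>b. b *\<^sub>R u) \<and> z \<in> range (\<lambda>b. b *\<^sub>R u)"
        using edge[of y z r] yz\<theta> \<theta>\<sigma> r by auto
      then obtain b b' where "y = b *\<^sub>R u" "z = b' *\<^sub>R u" by auto
      moreover have "h \<bullet> y = 1" "h \<bullet> z = 1" using yz\<theta> \<theta>_mem by blast+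
      ultimately have "b * (h \<bullet> u) = b' * (h \<bullet> u)" "y = b *\<^sub>R u" "z = b' *\<^sub>R u" by simp_all
      thus False using pos ne by simp
    qed
    hence "primitive N ((1 / (h \<bullet> u)) *\<^sub>R u)" using vert by (simp add: x_def)
    hence "1 / (h \<bullet> u) = 1" by (rule primitive_pos_multiple[OF lat u(2)]) (use pos in simp)
    thus ?thesis using pos by simp
  qed
  have u\<sigma>: "u1 \<in> \<sigma>" "u2 \<in> \<sigma>" unfolding cone by (auto intro: hull_inc)
  note line = mem_line_iff_cross2[OF nz(1)] mem_line_iff_cross2[OF nz(2)]
  have zero: "b = 0 \<and> b' = 0" if "0 \<le> b" "0 \<le> b'" "0 < r" "r < 1" "(1 - r) * b + r * b' = 0" for b b' r :: real
    using that by (smt (verit) mult_nonneg_nonneg mult_pos_pos)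
  have h1: "h \<bullet> u1 = 1"
  proof (rule unit[OF u\<sigma>(1) prim(1)])
    fix y z r assume yz: "y \<in> \<sigma>" "z \<in> \<sigma>" and r: "0 < r" "r < 1" "(1 - r) *\<^sub>R y + r *\<^sub>R z \<in> range (\<lambda>b. b *\<^sub>R u1)"
    obtain a b a' b' where ab: "0 \<le> b" "y = a *\<^sub>R u1 + b *\<^sub>R u2" "0 \<le> b'" "z = a' *\<^sub>R u1 + b' *\<^sub>R u2"
      using yz unfolding mem by blast
    have "(1 - r) * (b * cross2 u1 u2) + r * (b' * cross2 u1 u2) = 0" using r(3) unfolding line by (simp add: ab)
    hence "((1 - r) * b + r * b') * cross2 u1 u2 = 0" by (simp add: algebra_simps)
    hence "b = 0 \<and> b' = 0" using zero[OF ab(1,3) r(1,2)] cross by simp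
    thus "y \<in> range (\<lambda>b. b *\<^sub>R u1) \<and> z \<in> range (\<lambda>b. b *\<^sub>R u1)" unfolding line by (simp add: ab)
  qed
  have h2: "h \<bullet> u2 = 1"
  proof (rule unit[OF u\<sigma>(2) prim(2)])
    fix y z r assume yz: "y \<in> \<sigma>" "z \<in> \<sigma>" and r: "0 < r" "r < 1" "(1 - r) *\<^sub>R y + r *\<^sub>R z \<in> range (\<lambda>b. b *\<^sub>R u2)"
    obtain a b a' b' where ab: "0 \<le> a" "y = a *\<^sub>R u1 + b *\<^sub>R u2" "0 \<le> a'" "z = a' *\<^sub>R u1 + b' *\<^sub>R u2"
      using yz unfolding mem by blast
    have "(1 - r) * (a * cross2 u2 u1) + r * (a' * cross2 u2 u1) = 0" using r(3) unfolding line by (simp add: ab)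
    hence "((1 - r) * a + r * a') * cross2 u2 u1 = 0" by (simp add: algebra_simps)
    hence "a = 0 \<and> a' = 0" using zero[OF ab(1,3) r(1,2)] cross cross2_commute[of u1 u2] by simp
    thus "y \<in> range (\<lambda>b. b *\<^sub>R u2) \<and> z \<in> range (\<lambda>b. b *\<^sub>R u2)" unfolding line by (simp add: ab)
  qed
  have u\<Delta>: "u1 \<in> \<Delta>" "u2 \<in> \<Delta>"
    using ray(2)[OF u\<sigma>(1) nz(1)] ray(2)[OF u\<sigma>(2) nz(2)] h1 h2 \<theta>_mem by simp_all
  show "kappa \<Delta> (a *\<^sub>R u1 + b *\<^sub>R u2) = - (a + b)" if ab: "0 \<le> a" "0 \<le> b" for a b
  proof -
    define n where "n = a *\<^sub>R u1 + b *\<^sub>R u2"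
    have "(LEAST r::real. r \<ge> 0 \<and> n \<in> (\<lambda>y. r *\<^sub>R y) ` \<Delta>) = a + b"
    proof (rule Least_equality, intro conjI)
      show "0 \<le> a + b" using ab by simp
      show "n \<in> (\<lambda>y. (a + b) *\<^sub>R y) ` \<Delta>"
      proof (cases "a + b = 0")
        case True
        hence "a = 0" "b = 0" using ab by linarith+
        thus ?thesis using 0 by (auto simp: n_def image_iff)
      next
        case False
        have "(a / (a + b)) *\<^sub>R u1 + (b / (a + b)) *\<^sub>R u2 \<in> \<Delta>"
          using ab False u\<Delta> polytope_imp_convex[OF poly]
          by (intro convexD) (auto simp: add_divide_distrib[symmetric])
        moreover have "n = (a + b) *\<^sub>R ((a / (a + b)) *\<^sub>R u1 + (b / (a + b)) *\<^sub>R u2)"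
          using False by (simp add: n_def scaleR_add_right)
        ultimately show ?thesis by blast
      qed
    next
      fix r :: real assume r: "0 \<le> r \<and> n \<in> (\<lambda>y. r *\<^sub>R y) ` \<Delta>"
      then obtain y where y: "y \<in> \<Delta>" "n = r *\<^sub>R y" by blast
      have "a + b = h \<bullet> n" by (simp add: n_def inner_add_right h1 h2)
      also have "\<dots> = r * (h \<bullet> y)" by (simp add: y)
      also have "\<dots> \<le> r * 1" using h[OF y(1)] r by (intro mult_left_mono) auto
      finally show "a + b \<le> r" by simp
    qed
    thus ?thesis by (simp add: kappa_def n_def)
  qed
qed

theorem theorem3p4:
  fixes N \<Delta> \<sigma> :: "(real^2) set" and u1 u2 :: "real^2"
    and k :: nat and p :: "nat \<Rightarrow> real^2"
  assumes "is_lattice N"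
    and "LDP_polygon N \<Delta>"
    and "\<sigma> \<in> spanning_fan2 \<Delta>"
    and "primitive_generators N \<sigma> u1 u2"
    and "sail_points N u1 u2 k p"
  shows "12 * (\<Sum>n \<in> rel_interior (nabla u1 u2) \<inter> N. (kappa \<Delta> n + 1)\<^sup>2) =
    normalized_volume N (nabla u1 u2 - sail N u1 u2) +
    (\<Sum>i\<in>{1..<k}. normalized_volume (dual_lattice N)
       (convex hull {m_cone u1 u2, m_sub N p i, m_sub N p (i + 1)}))"
proof -
  obtain e1 e2 s t l where "lattice_triangle N e1 e2 u1 u2 s t l"
    using adapted_basis[OF assms(1)] edge_cone_cross2[OF assms(1-4)] assms(4)
    unfolding primitive_generators_def by blast
  then interpret lattice_triangle N e1 e2 u1 u2 s t l .
  interpret lattice_triangle_chain N e1 e2 u1 u2 s t l k p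
    by unfold_locales (rule assms(5))
  have "kappa \<Delta> n + 1 = 1 - Y n / of_int l" if n: "n \<in> rel_interior (nabla u1 u2)" for n
  proof -
    define a b where "a = D u2 n / D u2 u1" and "b = D n u1 / D u2 u1"
    have ab: "0 \<le> a" "0 \<le> b" using n D_u_pos by (auto simp: rel_interior_T a_def b_def)
    have eq: "n = a *\<^sub>R u1 + b *\<^sub>R u2"
      using D_expand_div[of u2 u1 n] D_u_pos by (simp add: a_def b_def add.commute)
    have "Y n / of_int l = a + b" using l_pos unfolding eq by (simp add: field_simps)
    thus ?thesis using edge_cone_kappa[OF assms(1-4) ab] eq by simp
  qed
  thus ?thesis using triangle_formula by simp
qed

end
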